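(* Let $\mathbb{F}$ be a field. Let $X$ be a simplicial complex and let $\Gamma$ be a finite collection of subcomplexes of $X$ such that $\bigcup\Gamma=X$. Let $\ell$ be an integer such that $-1\le\ell<|\Gamma|$. Suppose that $\widetilde{H}_{|\sigma|-2}\big(\bigcup\sigma,\mathbb{F}\big)=0$ for every simplex $\sigma\in N(\Gamma)$ of dimension at most $\ell$. Then $\dim\widetilde{H}_{\ell}(N(\Gamma),\mathbb{F})\le\dim\widetilde{H}_{\ell}(X,\mathbb{F})$.
   Context: Simplicial complexes are abstract and the empty set is not a simplex, so the minimal dimension of a simplex is $0$ (a complex may be empty). $\widetilde{H}$ denotes reduced simplicial homology; $\widetilde{H}_{-1}(Y,\mathbb{F})=0$ if and only if $Y$ is nonempty. A collection allows repetitions, and cardinalities are counted with repetitions. For a finite collection $\Gamma$ of subcomplexes of a simplicial complex, the nerve $N(\Gamma)$ is the simplicial complex whose vertices are the subcomplexes in $\Gamma$ and whose simplices are the (nonempty) subcollections of $\Gamma$ with nonempty intersection. For $\sigma\in N(\Gamma)$, $|\sigma|$ is the number of members of $\sigma$ (so $\dim\sigma=|\sigma|-1$), and $\bigcup\sigma$ is the union of the subcomplexes in $\sigma$. *)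

theory Defs
  imports
    "HOL-Algebra.AbelCoset"
    "Jordan_Normal_Form.VS_Connect"
    "HOL-Combinatorics.Permutations"
    "HOL-Library.Extended_Nat"
begin

definition simplicial_complex :: "'a set set \<Rightarrow> bool" where
  "simplicial_complex X \<longleftrightarrow>
     (\<forall>\<sigma>\<in>X. finite \<sigma> \<and> \<sigma> \<noteq> {} \<and> (\<forall>\<tau>\<subseteq>\<sigma>. \<tau> \<noteq> {} \<longrightarrow> \<tau> \<in> X))"

definition subcomplex :: "'a set set \<Rightarrow> 'a set set \<Rightarrow> bool" where
  "subcomplex A X \<longleftrightarrow> simplicial_complex A \<and> A \<subseteq> X"

(* The collection is the family (\<Gamma> i), i \<in> I, so that repetitions are allowed and a
   subcollection is a set of indices. The intersection is one of complexes, i.e. of sets of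
   simplices; as the empty set is not a simplex, it is nonempty iff the members of \<sigma> have a
   common vertex. In particular the index of an empty subcomplex is not a vertex of the nerve. *)
definition nerve :: "'i set \<Rightarrow> ('i \<Rightarrow> 'a set set) \<Rightarrow> 'i set set" where
  "nerve I \<Gamma> = {\<sigma>. \<sigma> \<subseteq> I \<and> \<sigma> \<noteq> {} \<and> (\<Inter>i\<in>\<sigma>. \<Gamma> i) \<noteq> {}}"


(* Oriented simplicial chains. An ordering of the vertices of a k-simplex is a distinct list of
   length k + 1. A k-chain is a finitely supported function c on these lists that changes by the
   sign of p when the list is permuted by p; it stands for the sum of c [v0,...,vk] times the
   oriented simplex [v0,...,vk], with one ordering taken for each simplex. For k = -1 the only
   list is [], so that the (-1)-chains are the scalars (augmentation), whether or not X is empty. *)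
definition simplicial_chains :: "'f::field itself \<Rightarrow> 'a set set \<Rightarrow> int \<Rightarrow> ('a list \<Rightarrow> 'f) set" where
  "simplicial_chains F X k = {c.
     finite {xs. c xs \<noteq> 0} \<and>
     (\<forall>xs. c xs \<noteq> 0 \<longrightarrow> distinct xs \<and> int (length xs) = k + 1 \<and> (xs = [] \<or> set xs \<in> X)) \<and>
     (\<forall>xs p. p permutes {..<length xs} \<longrightarrow> c (permute_list p xs) = of_int (sign p) * c xs)}"

(* The usual boundary, [v0,...,vk] \<mapsto> (\<Sum>i\<le>k. (-1)^i [v0,..,vi omitted,..,vk]), in terms of
   coefficients: a face ys occurs in the boundary of the simplices spanned by x and ys, and with
   sign +1 in that of the oriented simplex x # ys. See boundary_oriented_simplex below. *)
definition boundary :: "('a list \<Rightarrow> 'f::field) \<Rightarrow> 'a list \<Rightarrow> 'f" where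
  "boundary c ys = (\<Sum>x | c (x # ys) \<noteq> 0. c (x # ys))"

lemma chains_swap_adjacent:
  assumes "c \<in> simplicial_chains F X k"
  shows "c (us @ a # b # vs) = - c (us @ b # a # vs)"
proof -
  let ?n = "length us" and ?xs = "us @ b # a # vs"
  let ?p = "Transposition.transpose ?n (Suc ?n)"
  have p: "?p permutes {..<length ?xs}"
    by (rule permutes_swap_id) auto
  have "permute_list ?p ?xs = us @ a # b # vs"
  proof (rule nth_equalityI)
    fix i assume i: "i < length (permute_list ?p ?xs)"
    consider "i < ?n" | "i = ?n" | "i = Suc ?n" | j where "i = Suc (Suc (?n + j))"
      by (metis add_Suc_right less_iff_Suc_add linorder_neqE_nat not_less_eq)
    then show "permute_list ?p ?xs ! i = (us @ a # b # vs) ! i"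
      using i by cases (auto simp: permute_list_nth[OF p] nth_append transpose_def)
  qed simp
  moreover have "c (permute_list ?p ?xs) = of_int (sign ?p) * c ?xs"
    using assms p unfolding simplicial_chains_def by blast
  moreover have "sign ?p = - 1"
    by (simp add: sign_swap_id)
  ultimately show ?thesis by simp
qed

lemma chains_move_to_front:
  assumes "c \<in> simplicial_chains F X k"
  shows "c (a # us @ vs) = (- 1) ^ length us * c (us @ a # vs)"
proof (induction us arbitrary: vs rule: rev_induct)
  case (snoc u us)
  show ?case
    using snoc.IH[of "u # vs"] chains_swap_adjacent[OF assms, of us a u vs] by simp
qed simp

lemma boundary_oriented_simplex:
  assumes c: "c \<in> simplicial_chains F X k" and supp: "\<And>ys. c ys \<noteq> 0 \<Longrightarrow> set ys = set xs"
    and xs: "distinct xs" "i < length xs"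
  shows "boundary c (take i xs @ drop (Suc i) xs) = (- 1) ^ i * c xs"
proof -
  let ?ys = "take i xs @ drop (Suc i) xs"
  have dec: "xs = take i xs @ xs ! i # drop (Suc i) xs"
    using xs(2) by (simp add: id_take_nth_drop)
  have S: "{x. c (x # ?ys) \<noteq> 0} \<subseteq> {xs ! i}"
  proof
    fix x assume "x \<in> {x. c (x # ?ys) \<noteq> 0}"
    then have "set (x # ?ys) = set xs" "distinct (x # ?ys)"
      using supp c unfolding simplicial_chains_def by blast+
    moreover have "set xs = insert (xs ! i) (set ?ys)"
      by (subst dec) auto
    moreover have "xs ! i \<notin> set ?ys"
      using xs(1) by (subst (asm) dec) auto
    ultimately show "x \<in> {xs ! i}" by auto
  qed
  have "boundary c ?ys = (\<Sum>x\<in>{xs ! i}. c (x # ?ys))"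
    unfolding boundary_def by (rule sum.mono_neutral_left) (use S in auto)
  also have "\<dots> = (- 1) ^ i * c xs"
    using chains_move_to_front[OF c, of "xs ! i" "take i xs" "drop (Suc i) xs"] dec xs(2) by simp
  finally show ?thesis .
qed

definition chain_space ::
    "'f::field itself \<Rightarrow> 'a set set \<Rightarrow> int \<Rightarrow> ('f, 'a list \<Rightarrow> 'f) module" where
  "chain_space F X k =
     \<lparr>carrier = simplicial_chains F X k, mult = undefined, one = undefined,
      zero = (\<lambda>xs. 0), add = (\<lambda>c d xs. c xs + d xs), smult = (\<lambda>a c xs. a * c xs)\<rparr>"

definition cycles :: "'f::field itself \<Rightarrow> 'a set set \<Rightarrow> int \<Rightarrow> ('a list \<Rightarrow> 'f) set" where
  "cycles F X k = {c \<in> simplicial_chains F X k. boundary c = (\<lambda>xs. 0)}"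

definition boundaries :: "'f::field itself \<Rightarrow> 'a set set \<Rightarrow> int \<Rightarrow> ('a list \<Rightarrow> 'f) set" where
  "boundaries F X k = boundary ` simplicial_chains F X (k + 1)"

(* The smult operation sends the coset of v to the coset of a v, also for a = 0. *)
definition quotient_space :: "('f, 'v) module \<Rightarrow> 'v set \<Rightarrow> ('f, 'v set) module" where
  "quotient_space V U =
     \<lparr>carrier = a_rcosets\<^bsub>V\<^esub> U, mult = undefined, one = undefined,
      zero = U, add = set_add V, smult = (\<lambda>a A. \<Union>v\<in>A. U +>\<^bsub>V\<^esub> (a \<odot>\<^bsub>V\<^esub> v))\<rparr>"

definition reduced_homology ::
    "'f::field itself \<Rightarrow> 'a set set \<Rightarrow> int \<Rightarrow> ('f, ('a list \<Rightarrow> 'f) set) module" where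
  "reduced_homology F X k =
     quotient_space ((chain_space F X k)\<lparr>carrier := cycles F X k\<rparr>) (boundaries F X k)"

(* vectorspace.dim is only meaningful for finite-dimensional spaces. *)
definition vdim :: "('f::field, 'v) module \<Rightarrow> enat" where
  "vdim V = (if vectorspace.fin_dim class_ring V then enat (vectorspace.dim class_ring V) else \<infinity>)"

end

theory Submission
  imports Defs
begin

text \<open>The join complex \<open>mixed I I\<close> consists of the simplices \<open>x * \<tau>\<close> with \<open>x\<close> in all members of
  \<open>\<tau>\<close>; it contains both the union (\<open>\<tau>\<close> empty) and the nerve (\<open>x\<close> empty). For a nonempty \<open>x\<close> the
  admissible \<open>\<tau>\<close> form a full simplex, so the mixed complex is acyclic relative to the nerve without
  any hypothesis on the homology of the members. This gives a map from the homology of the union to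
  that of the mixed complex, hence of the nerve. It is surjective in degree \<open>l\<close>: by induction on the
  dimension, each simplex \<open>\<sigma>\<close> of the nerve of dimension at most \<open>l\<close> is deformed into the union of its
  members, inside the mixed complex of \<open>\<sigma>\<close>; the boundary of \<open>\<sigma>\<close> is already deformed to a cycle of
  degree \<open>card \<sigma> - 2\<close>, which the hypothesis allows to be filled.\<close>

section \<open>Alternating chains\<close>

text \<open>The number \<open>card \<sigma> - 2\<close> is the degree of the boundary of the simplex
  \<sigma>, so the hypothesis fills exactly the obstruction met when \<sigma> is deformed. An
  \<open>l\<close>-cycle of the nerve is a combination of \<open>l\<close>-simplices, hence only
  dimensions up to \<open>l\<close> have to be treated. The same method would need the simplices of
  dimension \<open>l + 1\<close> to show injectivity, which is why an inequality of dimensions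
  results. The nerve cycle attached to a cycle of the union is determined only up to boundaries;
  instead of choosing one, the proof works with the relation of being homologous in the mixed
  complex and shows that it induces a surjective linear map of quotients. Degree -1 fits in without
  a separate theory: its only ordering is the empty list, so the (-1)-chains of all the complexes
  coincide, and the deformation starts there with nothing to do.\<close>

lemma alternating_swap:
  fixes c :: "'a list \<Rightarrow> 'f::field"
  assumes "\<And>us a b vs. c (us @ a # b # vs) = - c (us @ b # a # vs)"
  shows "c (us @ a # ms @ b # vs) = - c (us @ b # ms @ a # vs)"
proof -
  have move: "c (us @ a # ms @ vs) = (- 1) ^ length ms * c (us @ ms @ a # vs)" for us a ms vs
  proof (induction ms arbitrary: us)
    case (Cons m ms)
    show ?case using Cons.IH[of "us @ [m]"] assms[of us a m "ms @ vs"] by simp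
  qed simp
  \<comment> \<open>Carry \<open>a\<close> across \<open>ms\<close>, exchange it with
    \<open>b\<close>, and carry \<open>b\<close> back: the two powers of -1 cancel and one sign
    remains.\<close>
  have "c (us @ a # ms @ b # vs) = (- 1) ^ length ms * c (us @ ms @ a # b # vs)"
    using move[of us a ms "b # vs"] by simp
  also have "\<dots> = - ((- 1) ^ length ms * c (us @ ms @ b # a # vs))"
    using assms[of "us @ ms" a b vs] by simp
  also have "\<dots> = - c (us @ b # ms @ a # vs)"
    using move[of us b ms "a # vs"] by simp
  finally show ?thesis .
qed

lemma permute_list_transpose:
  assumes "i < j" "j < length xs"
  shows "\<exists>us a ms b vs. xs = us @ a # ms @ b # vs \<and>
    permute_list (Transposition.transpose i j) xs = us @ b # ms @ a # vs"
proof -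
  let ?t = "Transposition.transpose i j"
  define us ms vs where "us = take i xs" and "ms = take (j - Suc i) (drop (Suc i) xs)"
    and "vs = drop (Suc j) xs"
  have "xs = us @ xs ! i # drop (Suc i) xs"
    using assms by (simp add: us_def id_take_nth_drop)
  moreover have "drop (Suc i) xs = ms @ xs ! j # vs"
    using id_take_nth_drop[of "j - Suc i" "drop (Suc i) xs"] assms by (simp add: ms_def vs_def)
  ultimately have xs: "xs = us @ xs ! i # ms @ xs ! j # vs" by simp
  have len: "length us = i" "length ms = j - Suc i" using assms by (auto simp: us_def ms_def)
  have p: "?t permutes {..<length xs}" using assms by (intro permutes_swap_id) auto
  have "permute_list ?t xs = us @ xs ! j # ms @ xs ! i # vs"
  proof (rule nth_equalityI)
    show "length (permute_list ?t xs) = length (us @ xs ! j # ms @ xs ! i # vs)"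
      by (subst xs) simp
    fix k assume "k < length (permute_list ?t xs)"
    then have k: "k < length xs" by simp
    have nth: "xs ! m = (us @ xs ! i # ms @ xs ! j # vs) ! m" for m using xs by simp
    consider "k < i" | "k = i" | "i < k" "k < j" | "k = j" | "j < k" by linarith
    then show "permute_list ?t xs ! k = (us @ xs ! j # ms @ xs ! i # vs) ! k"
    proof cases
      case 3
      then show ?thesis using assms k len nth[of k]
        by (simp add: permute_list_nth[OF p] nth_append transpose_def nth_Cons' split: if_splits)
    next
      case 5
      then show ?thesis using assms k len nth[of k]
        by (simp add: permute_list_nth[OF p] nth_append transpose_def nth_Cons' split: if_splits)
    next
      case 1
      then show ?thesis using assms k len nth[of k]
        by (simp add: permute_list_nth[OF p] nth_append transpose_def)
    qed (use assms k len in \<open>simp_all add: permute_list_nth[OF p] nth_append transpose_def nth_Cons'\<close>)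
  qed
  then show ?thesis using xs by blast
qed

lemma alternating_permute:
  fixes c :: "'a list \<Rightarrow> 'f::field"
  assumes "\<And>us a b vs. c (us @ a # b # vs) = - c (us @ b # a # vs)"
    and "p permutes {..<length xs}"
  shows "c (permute_list p xs) = of_int (sign p) * c xs"
proof -
  \<comment> \<open>All lists of length \<open>n\<close> are treated together, since the induction
    hypothesis for \<open>p\<close> is applied to the transposed list.\<close>
  have "\<forall>xs. length xs = n \<longrightarrow> c (permute_list p xs) = of_int (sign p) * c xs"
    if "p permutes {..<n}" for n
    using that finite_lessThan
  proof (induction p rule: permutes_induct)
    case (swap i j p)
    show ?case
    proof (intro allI impI)
      fix xs :: "'a list" assume n: "length xs = n"
      let ?t = "Transposition.transpose i j"
      have "c (permute_list ?t xs) = - c xs"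
      proof (cases "i < j")
        case True
        then obtain us a ms b vs where "xs = us @ a # ms @ b # vs"
          "permute_list ?t xs = us @ b # ms @ a # vs"
          using permute_list_transpose[of i j xs] swap n by auto
        then show ?thesis
          using alternating_swap[of c us b ms a vs, OF assms(1)] by simp
      next
        case False
        then have "j < i" using swap by simp
        then obtain us a ms b vs where "xs = us @ a # ms @ b # vs"
          "permute_list ?t xs = us @ b # ms @ a # vs"
          using permute_list_transpose[of j i xs] swap n by (auto simp: transpose_commute)
        then show ?thesis
          using alternating_swap[of c us b ms a vs, OF assms(1)] by simp
      qed
      moreover have "c (permute_list p (permute_list ?t xs)) = of_int (sign p) * c (permute_list ?t xs)"
        using swap.IH n by simp
      moreover have "permute_list (?t \<circ> p) xs = permute_list p (permute_list ?t xs)"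
        by (rule permute_list_compose) (use swap n in simp)
      moreover have "sign (?t \<circ> p) = - sign p"
        using swap sign_compose[of ?t p] permutes_imp_permutation[of "{..<n}" p]
        by (simp add: sign_swap_id permutation_swap_id)
      ultimately show "c (permute_list (?t \<circ> p) xs) = of_int (sign (?t \<circ> p)) * c xs"
        by simp
    qed
  qed simp
  then show ?thesis using assms(2) by blast
qed

text \<open>Adjacent transpositions generate all permutations, so only they need checking.
  Membership in the chain spaces is established through this form from here on.\<close>

lemma mem_chains_iff:
  "c \<in> simplicial_chains F X k \<longleftrightarrow>
     finite {xs. c xs \<noteq> 0} \<and>
     (\<forall>xs. c xs \<noteq> 0 \<longrightarrow> distinct xs \<and> int (length xs) = k + 1 \<and> (xs = [] \<or> set xs \<in> X)) \<and>
     (\<forall>us a b vs. c (us @ a # b # vs) = - c (us @ b # a # vs))" (is "_ \<longleftrightarrow> ?R")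
proof
  assume c: "c \<in> simplicial_chains F X k"
  then show ?R using chains_swap_adjacent[OF c] unfolding simplicial_chains_def by blast
next
  assume ?R
  then show "c \<in> simplicial_chains F X k"
    unfolding simplicial_chains_def using alternating_permute[of c] by blast
qed

lemma chainsI:
  assumes "finite {xs. c xs \<noteq> 0}"
    and "\<And>xs. c xs \<noteq> 0 \<Longrightarrow> distinct xs \<and> int (length xs) = k + 1 \<and> (xs = [] \<or> set xs \<in> X)"
    and "\<And>us a b vs. c (us @ a # b # vs) = - c (us @ b # a # vs)"
  shows "c \<in> simplicial_chains F X k"
  unfolding mem_chains_iff using assms by blast

lemma chains_finite: "c \<in> simplicial_chains F X k \<Longrightarrow> finite {xs. c xs \<noteq> 0}"
  unfolding mem_chains_iff by blast

lemma chains_support: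
  assumes "c \<in> simplicial_chains F X k" "c xs \<noteq> 0"
  shows "distinct xs" "int (length xs) = k + 1" "xs \<noteq> [] \<Longrightarrow> set xs \<in> X"
  using assms unfolding mem_chains_iff by blast+

lemma chains_zero: "(\<lambda>xs. 0) \<in> simplicial_chains F X k"
  by (rule chainsI) auto

lemma chains_add:
  assumes "c \<in> simplicial_chains F X k" "d \<in> simplicial_chains F X k"
  shows "(\<lambda>xs. c xs + d xs) \<in> simplicial_chains F X k"
proof (rule chainsI)
  have "{xs. c xs + d xs \<noteq> 0} \<subseteq> {xs. c xs \<noteq> 0} \<union> {xs. d xs \<noteq> 0}" by auto
  then show "finite {xs. c xs + d xs \<noteq> 0}"
    using finite_subset[OF _ finite_UnI[OF chains_finite[OF assms(1)] chains_finite[OF assms(2)]]]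
    by blast
next
  fix xs assume "c xs + d xs \<noteq> 0"
  then have "c xs \<noteq> 0 \<or> d xs \<noteq> 0" by auto
  then show "distinct xs \<and> int (length xs) = k + 1 \<and> (xs = [] \<or> set xs \<in> X)"
    using chains_support[OF assms(1)] chains_support[OF assms(2)] by metis
next
  fix us a b vs
  show "c (us @ a # b # vs) + d (us @ a # b # vs) = - (c (us @ b # a # vs) + d (us @ b # a # vs))"
    using chains_swap_adjacent[OF assms(1), of us a b vs]
      chains_swap_adjacent[OF assms(2), of us a b vs] by simp
qed

lemma chains_smult:
  assumes "c \<in> simplicial_chains F X k"
  shows "(\<lambda>xs. a * c xs) \<in> simplicial_chains F X k"
proof (rule chainsI)
  have "{xs. a * c xs \<noteq> 0} \<subseteq> {xs. c xs \<noteq> 0}" by auto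
  then show "finite {xs. a * c xs \<noteq> 0}"
    using chains_finite[OF assms] finite_subset by blast
next
  fix xs assume "a * c xs \<noteq> 0"
  then show "distinct xs \<and> int (length xs) = k + 1 \<and> (xs = [] \<or> set xs \<in> X)"
    using chains_support[OF assms, of xs] by auto
next
  fix us x y vs
  show "a * c (us @ x # y # vs) = - (a * c (us @ y # x # vs))"
    using chains_swap_adjacent[OF assms, of us x y vs] by simp
qed

lemma chains_uminus:
  "c \<in> simplicial_chains F X k \<Longrightarrow> (\<lambda>xs. - c xs) \<in> simplicial_chains F X k"
  using chains_smult[of c F X k "- 1"] by simp

lemma chains_diff:
  assumes "c \<in> simplicial_chains F X k" "d \<in> simplicial_chains F X k"
  shows "(\<lambda>xs. c xs - d xs) \<in> simplicial_chains F X k"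
  using chains_add[OF assms(1) chains_uminus[OF assms(2)]] by simp

lemma chains_sum:
  assumes "\<And>s. s \<in> S \<Longrightarrow> e s \<in> simplicial_chains F X k"
  shows "(\<lambda>xs. \<Sum>s\<in>S. e s xs) \<in> simplicial_chains F X k"
  using assms
proof (induction S rule: infinite_finite_induct)
  case (insert s S)
  then show ?case using chains_add[of "e s" F X k "\<lambda>xs. \<Sum>s\<in>S. e s xs"] by simp
qed (simp_all add: chains_zero)

lemma chains_supportI:
  assumes "c \<in> simplicial_chains F X k" "\<And>xs. c xs \<noteq> 0 \<Longrightarrow> xs \<noteq> [] \<Longrightarrow> set xs \<in> Y"
  shows "c \<in> simplicial_chains F Y k"
  using assms unfolding mem_chains_iff by blast

lemma chains_mono: "c \<in> simplicial_chains F X k \<Longrightarrow> X \<subseteq> Y \<Longrightarrow> c \<in> simplicial_chains F Y k"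
  using chains_supportI[of c F X k Y] chains_support(3)[of c F X k] by blast

text \<open>The predicate sees only the set of vertices, so it does not change when a list is
  reordered and alternation survives.\<close>

lemma chains_restrict:
  fixes c :: "'a list \<Rightarrow> 'f::field"
  assumes "c \<in> simplicial_chains F X k"
  shows "(\<lambda>xs. if P (set xs) then c xs else 0) \<in> simplicial_chains F X k"
proof (rule chainsI)
  have "{xs. (if P (set xs) then c xs else 0) \<noteq> 0} \<subseteq> {xs. c xs \<noteq> 0}" by auto
  then show "finite {xs. (if P (set xs) then c xs else 0) \<noteq> 0}"
    using chains_finite[OF assms] finite_subset by blast
next
  fix xs assume "(if P (set xs) then c xs else 0) \<noteq> 0"
  then show "distinct xs \<and> int (length xs) = k + 1 \<and> (xs = [] \<or> set xs \<in> X)"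
    using chains_support[OF assms, of xs] by (auto split: if_splits)
next
  fix us a b and vs :: "'a list"
  have "set (us @ a # b # vs) = set (us @ b # a # vs)" by auto
  then show "(if P (set (us @ a # b # vs)) then c (us @ a # b # vs) else 0) =
      - (if P (set (us @ b # a # vs)) then c (us @ b # a # vs) else 0)"
    using chains_swap_adjacent[OF assms, of us a b vs] by (simp add: insert_commute)
qed

lemma chains_move_to_front':
  assumes "c \<in> simplicial_chains F X k"
  shows "c (us @ a # vs) = (- 1) ^ length us * c (a # us @ vs)"
  using chains_move_to_front[OF assms, of a us vs]
  by (simp add: mult.assoc[symmetric] flip: power_mult_distrib)

text \<open>The scalar is the sign of the reordering, the same for both chains. Two chains can
  therefore be compared on a simplex at a single ordering.\<close>

lemma chains_same_simplex:
  fixes c e :: "'a list \<Rightarrow> 'f::field"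
  assumes "c \<in> simplicial_chains F X k" "e \<in> simplicial_chains F Y k'"
    and "distinct xs" "distinct ys" "set xs = set ys"
  shows "\<exists>a. a \<noteq> 0 \<and> c ys = a * c xs \<and> e ys = a * e xs"
proof -
  have "mset ys = mset xs" using assms(3-5) by (simp add: set_eq_iff_mset_eq_distinct)
  then obtain p where p: "p permutes {..<length xs}" "permute_list p xs = ys"
    by (rule mset_eq_permutation)
  have "c ys = of_int (sign p) * c xs" "e ys = of_int (sign p) * e xs"
    using assms(1,2) p unfolding simplicial_chains_def by blast+
  moreover have "of_int (sign p) \<noteq> (0::'f)" by (simp add: sign_def)
  ultimately show ?thesis by (intro exI[of _ "of_int (sign p)"] conjI)
qed

section \<open>The boundary operator and cones\<close>

text \<open>A finite summation range that serves all faces at once; the range in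
  \<open>boundary\<close> varies with the face.\<close>

definition vertices :: "('a list \<Rightarrow> 'f::zero) \<Rightarrow> 'a set" where
  "vertices c = (\<Union>xs\<in>{xs. c xs \<noteq> 0}. set xs)"

lemma finite_vertices: "c \<in> simplicial_chains F X k \<Longrightarrow> finite (vertices c)"
  unfolding vertices_def using chains_finite by blast

lemma mem_vertices: "c xs \<noteq> 0 \<Longrightarrow> x \<in> set xs \<Longrightarrow> x \<in> vertices c"
  unfolding vertices_def by blast

lemma boundary_eq_sum:
  assumes "finite A" "{x. c (x # ys) \<noteq> 0} \<subseteq> A"
  shows "boundary c ys = (\<Sum>x\<in>A. c (x # ys))"
  unfolding boundary_def by (rule sum.mono_neutral_left) (use assms in auto)

lemma boundary_eq_sum_vertices:
  assumes "c \<in> simplicial_chains F X k"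
  shows "boundary c ys = (\<Sum>x\<in>vertices c. c (x # ys))"
  by (rule boundary_eq_sum[OF finite_vertices[OF assms]]) (auto intro: mem_vertices)

lemma boundary_add:
  assumes "c \<in> simplicial_chains F X k" "d \<in> simplicial_chains F Y k'"
  shows "boundary (\<lambda>xs. c xs + d xs) = (\<lambda>ys. boundary c ys + boundary d ys)"
proof
  fix ys
  let ?A = "vertices c \<union> vertices d"
  have "finite ?A" using assms finite_vertices by blast
  then have *: "boundary e ys = (\<Sum>x\<in>?A. e (x # ys))" if "\<And>xs. e xs \<noteq> 0 \<Longrightarrow> c xs \<noteq> 0 \<or> d xs \<noteq> 0" for e
    by (rule boundary_eq_sum) (use that mem_vertices[of c] mem_vertices[of d] in force)
  have "boundary c ys = (\<Sum>x\<in>?A. c (x # ys))" "boundary d ys = (\<Sum>x\<in>?A. d (x # ys))"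
    "boundary (\<lambda>xs. c xs + d xs) ys = (\<Sum>x\<in>?A. c (x # ys) + d (x # ys))"
    by (rule *; auto)+
  then show "boundary (\<lambda>xs. c xs + d xs) ys = boundary c ys + boundary d ys"
    by (simp add: sum.distrib)
qed

lemma boundary_zero: "boundary (\<lambda>xs. 0) = (\<lambda>ys. 0)"
  by (simp add: boundary_def fun_eq_iff)

lemma boundary_smult: "boundary (\<lambda>xs. a * c xs) = (\<lambda>ys. a * boundary c ys)"
  by (cases "a = 0") (simp_all add: boundary_def fun_eq_iff sum_distrib_left)

lemma boundary_uminus: "boundary (\<lambda>xs. - c xs) = (\<lambda>ys. - boundary c ys)"
  using boundary_smult[of "- 1" c] by simp

lemma boundary_diff:
  assumes "c \<in> simplicial_chains F X k" "d \<in> simplicial_chains F Y k'"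
  shows "boundary (\<lambda>xs. c xs - d xs) = (\<lambda>ys. boundary c ys - boundary d ys)"
  using boundary_add[OF assms(1) chains_uminus[OF assms(2)]] by (simp add: boundary_uminus)

lemma boundary_sum:
  assumes "\<And>s. s \<in> S \<Longrightarrow> e s \<in> simplicial_chains F X k"
  shows "boundary (\<lambda>xs. \<Sum>s\<in>S. e s xs) = (\<lambda>ys. \<Sum>s\<in>S. boundary (e s) ys)"
  using assms
proof (induction S rule: infinite_finite_induct)
  case (insert s S)
  then show ?case
    using boundary_add[of "e s" F X k "\<lambda>xs. \<Sum>s\<in>S. e s xs" X k] chains_sum[of S e F X k] by simp
qed (simp_all add: boundary_zero)

lemma boundary_support:
  assumes "boundary c ys \<noteq> 0"
  obtains x where "c (x # ys) \<noteq> 0"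
  using assms unfolding boundary_def by (metis (mono_tags, lifting) mem_Collect_eq sum.neutral)

lemma boundary_chains:
  fixes c :: "'a list \<Rightarrow> 'f::field"
  assumes c: "c \<in> simplicial_chains F X k"
    and X: "\<And>s t. s \<in> X \<Longrightarrow> t \<subseteq> s \<Longrightarrow> t \<noteq> {} \<Longrightarrow> t \<in> X"
  shows "boundary c \<in> simplicial_chains F X (k - 1)"
proof (rule chainsI)
  have "{ys. boundary c ys \<noteq> 0} \<subseteq> tl ` {xs. c xs \<noteq> 0}"
  proof
    fix ys assume "ys \<in> {ys. boundary c ys \<noteq> 0}"
    then obtain x where "c (x # ys) \<noteq> 0" by (auto elim: boundary_support)
    then show "ys \<in> tl ` {xs. c xs \<noteq> 0}" by force
  qed
  then show "finite {ys. boundary c ys \<noteq> 0}"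
    using chains_finite[OF c] finite_surj by blast
next
  fix ys assume "boundary c ys \<noteq> 0"
  then obtain x where "c (x # ys) \<noteq> 0" by (rule boundary_support)
  note supp = chains_support[OF c this]
  have "set ys \<in> X" if "ys \<noteq> []" using X[OF supp(3), of "set ys"] that by auto
  then show "distinct ys \<and> int (length ys) = k - 1 + 1 \<and> (ys = [] \<or> set ys \<in> X)"
    using supp by auto
next
  fix us a b vs
  have "boundary c (us @ a # b # vs) = (\<Sum>x\<in>vertices c. c ((x # us) @ a # b # vs))"
    by (simp add: boundary_eq_sum_vertices[OF c])
  also have "\<dots> = (\<Sum>x\<in>vertices c. - c ((x # us) @ b # a # vs))"
    by (rule sum.cong) (rule refl, rule chains_swap_adjacent[OF c])
  also have "\<dots> = - boundary c (us @ b # a # vs)"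
    by (simp add: boundary_eq_sum_vertices[OF c] sum_negf)
  finally show "boundary c (us @ a # b # vs) = - boundary c (us @ b # a # vs)" .
qed

text \<open>Vanishing on the diagonal is assumed because of characteristic 2.\<close>
lemma sum_antisymmetric_zero:
  fixes f :: "'a \<Rightarrow> 'a \<Rightarrow> 'f::comm_ring"
  assumes "finite S" "\<And>x. f x x = 0" "\<And>x y. f x y = - f y x"
  shows "(\<Sum>x\<in>S. \<Sum>y\<in>S. f x y) = 0"
  using assms(1)
proof induction
  case (insert s S)
  have "(\<Sum>x\<in>S. f x s) = - (\<Sum>x\<in>S. f s x)"
    unfolding sum_negf[symmetric] by (rule sum.cong) (auto intro: assms(3))
  then show ?case using insert by (simp add: sum.distrib assms(2))
qed simp

text \<open>The double sum of \<open>c (x # y # ys)\<close> is antisymmetric in \<open>x\<close> and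
  \<open>y\<close>, and its diagonal vanishes because the lists in the support are distinct.\<close>

lemma boundary_boundary:
  fixes c :: "'a list \<Rightarrow> 'f::field"
  assumes c: "c \<in> simplicial_chains F X k"
  shows "boundary (boundary c) = (\<lambda>xs. 0)"
proof
  fix ys
  let ?V = "vertices c"
  have "boundary (boundary c) ys = (\<Sum>y\<in>?V. boundary c (y # ys))"
  proof (rule boundary_eq_sum[OF finite_vertices[OF c]], safe)
    fix y assume "boundary c (y # ys) \<noteq> 0"
    then obtain x where "c (x # y # ys) \<noteq> 0" by (rule boundary_support)
    then show "y \<in> ?V" by (rule mem_vertices) simp
  qed
  also have "\<dots> = (\<Sum>y\<in>?V. \<Sum>x\<in>?V. c (x # y # ys))"
    by (simp add: boundary_eq_sum_vertices[OF c])
  also have "\<dots> = 0"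
  proof (rule sum_antisymmetric_zero[OF finite_vertices[OF c]])
    show "c (x # x # ys) = 0" for x using chains_support(1)[OF c, of "x # x # ys"] by auto
    show "c (x # y # ys) = - c (y # x # ys)" for x y
      using chains_swap_adjacent[OF c, of "[]" x y ys] by simp
  qed
  finally show "boundary (boundary c) ys = 0" .
qed

section \<open>Cones and the removal of paired simplices\<close>

text \<open>The cone with apex \<open>v\<close> in terms of coefficients: the first \<open>v\<close>
  is deleted from the list, with a sign given by its position, and lists without \<open>v\<close>
  get 0. The recursion fixes leading entries of \<open>c\<close>, which is also how
  \<open>boundary\<close> evaluates a chain.\<close>

fun cone :: "'a \<Rightarrow> ('a list \<Rightarrow> 'f::ab_group_add) \<Rightarrow> 'a list \<Rightarrow> 'f" where
  "cone v c [] = 0"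
| "cone v c (x # xs) = (if x = v then c xs else - cone v (\<lambda>ys. c (x # ys)) xs)"

lemma cone_support:
  "cone v c ys \<noteq> 0 \<Longrightarrow> \<exists>us vs. ys = us @ v # vs \<and> c (us @ vs) \<noteq> 0"
proof (induction ys arbitrary: c)
  case (Cons y ys)
  show ?case
  proof (cases "y = v")
    case True
    then show ?thesis using Cons.prems by - (rule exI[of _ "[]"], rule exI[of _ ys], simp)
  next
    case False
    then obtain us vs where "ys = us @ v # vs" "c (y # us @ vs) \<noteq> 0"
      using Cons.IH[of "\<lambda>ys. c (y # ys)"] Cons.prems by auto
    then show ?thesis using False by - (rule exI[of _ "y # us"], rule exI[of _ vs], simp)
  qed
qed simp

lemma cone_uminus: "cone v (\<lambda>xs. - c xs) ys = - cone v c ys"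
  by (induction ys arbitrary: c) auto

lemma cone_sum: "cone v (\<lambda>xs. \<Sum>s\<in>S. e s xs) ys = (\<Sum>s\<in>S. cone v (e s) ys)"
  by (induction ys arbitrary: e) (auto simp: sum_negf)

lemma cone_swap:
  assumes "\<And>us a b vs. c (us @ a # b # vs) = - c (us @ b # a # vs)"
    and "\<And>xs. v \<in> set xs \<Longrightarrow> c xs = 0"
  shows "cone v c (us @ a # b # vs) = - cone v c (us @ b # a # vs)"
  using assms
proof (induction us arbitrary: c)
  case Nil
  have "(\<lambda>zs. c (a # b # zs)) = (\<lambda>zs. - c (b # a # zs))"
    using Nil(1)[of "[]" a b] by auto
  then have "cone v (\<lambda>zs. c (a # b # zs)) vs = - cone v (\<lambda>zs. c (b # a # zs)) vs"
    by (simp add: cone_uminus)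
  \<comment> \<open>For \<open>a = b = v\<close> the claim reads
    \<open>c (v # vs) = - c (v # vs)\<close>; in general this forces the value to be 0, which the
    second assumption supplies.\<close>
  then show ?case using Nil(2)[of "v # vs"] by auto
next
  case (Cons x us)
  have "cone v (\<lambda>zs. c (x # zs)) (us @ a # b # vs) = - cone v (\<lambda>zs. c (x # zs)) (us @ b # a # vs)"
  proof (rule Cons.IH)
    show "c (x # us @ a # b # vs) = - c (x # us @ b # a # vs)" for us a b vs
      using Cons.prems(1)[of "x # us" a b vs] by simp
    show "c (x # xs) = 0" if "v \<in> set xs" for xs
      using Cons.prems(2)[of "x # xs"] that by simp
  qed
  then show ?case using Cons.prems(1)[of us a b vs] by simp
qed

lemma cone_chains:
  fixes c :: "'a list \<Rightarrow> 'f::field"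
  assumes c: "c \<in> simplicial_chains F X k"
    and v: "\<And>xs. c xs \<noteq> 0 \<Longrightarrow> v \<notin> set xs \<and> insert v (set xs) \<in> Y"
  shows "cone v c \<in> simplicial_chains F Y (k + 1)"
proof (rule chainsI)
  have "{ys. cone v c ys \<noteq> 0} \<subseteq>
    (\<Union>xs\<in>{xs. c xs \<noteq> 0}. (\<lambda>n. take n xs @ v # drop n xs) ` {..length xs})"
  proof
    fix ys assume "ys \<in> {ys. cone v c ys \<noteq> 0}"
    then obtain us vs where *: "ys = us @ v # vs" "c (us @ vs) \<noteq> 0"
      using cone_support[of v c ys] by auto
    then have "ys = take (length us) (us @ vs) @ v # drop (length us) (us @ vs)" by simp
    then have "ys \<in> (\<lambda>n. take n (us @ vs) @ v # drop n (us @ vs)) ` {..length (us @ vs)}"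
      by (rule image_eqI) simp
    then show "ys \<in> (\<Union>xs\<in>{xs. c xs \<noteq> 0}. (\<lambda>n. take n xs @ v # drop n xs) ` {..length xs})"
      using *(2) by blast
  qed
  then show "finite {ys. cone v c ys \<noteq> 0}"
    by (rule finite_subset) (use chains_finite[OF c] in auto)
next
  fix ys assume "cone v c ys \<noteq> 0"
  then obtain us vs where *: "ys = us @ v # vs" "c (us @ vs) \<noteq> 0"
    using cone_support[of v c ys] by auto
  then show "distinct ys \<and> int (length ys) = k + 1 + 1 \<and> (ys = [] \<or> set ys \<in> Y)"
    using chains_support[OF c *(2)] v[OF *(2)] by auto
next
  show "cone v c (us @ a # b # vs) = - cone v c (us @ b # a # vs)" for us a b vs
    by (rule cone_swap) (use chains_swap_adjacent[OF c] v in blast)+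
qed

text \<open>In the sum over the new first entry, the apex contributes \<open>c ys\<close>. Every
  other vertex passes into the recursion with a minus sign, and these terms add up to the cone over
  the boundary because \<open>cone\<close> is additive.\<close>

lemma boundary_cone:
  fixes c :: "'a list \<Rightarrow> 'f::field"
  assumes c: "c \<in> simplicial_chains F X k" and v: "\<And>xs. c xs \<noteq> 0 \<Longrightarrow> v \<notin> set xs"
  shows "boundary (cone v c) ys = c ys - cone v (boundary c) ys"
proof -
  let ?V = "vertices c"
  have vV: "v \<notin> ?V" using v by (auto simp: vertices_def)
  have "boundary (cone v c) ys = (\<Sum>x\<in>insert v ?V. cone v c (x # ys))"
  proof (rule boundary_eq_sum)
    show "finite (insert v ?V)" using finite_vertices[OF c] by simp
    have "x = v" if "cone v c (x # ys) \<noteq> 0" "x \<notin> ?V" for x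
    proof -
    from that obtain us vs where *: "x # ys = us @ v # vs" "c (us @ vs) \<noteq> 0"
      using cone_support[of v c "x # ys"] by auto
    have "us = []"
    proof (rule ccontr)
      assume "us \<noteq> []"
      then have "x \<in> set us" using *(1) by (cases us) auto
      then show False using mem_vertices[of c "us @ vs" x] * \<open>x \<notin> ?V\<close> by simp
    qed
    then show "x = v" using * by simp
    qed
    then show "{x. cone v c (x # ys) \<noteq> 0} \<subseteq> insert v ?V" by blast
  qed
  also have "\<dots> = c ys + (\<Sum>x\<in>?V. - cone v (\<lambda>zs. c (x # zs)) ys)"
    using finite_vertices[OF c] vV by (auto intro!: sum.cong)
  also have "(\<Sum>x\<in>?V. - cone v (\<lambda>zs. c (x # zs)) ys) = - cone v (boundary c) ys"
    using cone_sum[of v "\<lambda>x zs. c (x # zs)" ?V ys]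
    by (simp add: sum_negf boundary_eq_sum_vertices[OF c, abs_def])
  finally show ?thesis by simp
qed

text \<open>The simplices of \<open>K\<close> outside \<open>L\<close>, with the empty simplex counted unless \<open>{} \<in> L\<close>, come in
  pairs \<open>s\<close>, \<open>insert v s\<close>; coning off those without \<open>v\<close> removes all of them.\<close>
lemma push_off_pairs:
  fixes c :: "'a list \<Rightarrow> 'f::field"
  assumes c: "c \<in> simplicial_chains F K k"
    and K: "\<And>s t. s \<in> K \<Longrightarrow> t \<subseteq> s \<Longrightarrow> t \<noteq> {} \<Longrightarrow> t \<in> K"
    and dc: "\<And>xs. boundary c xs \<noteq> 0 \<Longrightarrow> set xs \<in> L"
    and L: "\<And>x s. insert x s \<in> L \<Longrightarrow> s \<in> L"
    and out: "\<And>s. s \<in> insert {} K \<Longrightarrow> s \<notin> L \<Longrightarrow> insert v s \<in> K"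
    and inside: "\<And>s. s \<in> L \<Longrightarrow> insert v s \<in> K \<Longrightarrow> insert v s \<in> L"
  shows "\<exists>h\<in>simplicial_chains F K (k + 1). \<forall>xs. c xs - boundary h xs \<noteq> 0 \<longrightarrow> set xs \<in> L"
proof -
  \<comment> \<open>The part of \<open>c\<close> to be coned off: simplices outside \<open>L\<close>
    that lack \<open>v\<close>. Those containing \<open>v\<close> take care of themselves
    below.\<close>
  define c' where "c' = (\<lambda>xs. if set xs \<notin> L \<and> v \<notin> set xs then c xs else 0)"
  have c': "c' \<in> simplicial_chains F K k"
    unfolding c'_def by (rule chains_restrict[OF c, of "\<lambda>s. s \<notin> L \<and> v \<notin> s"])
  have c'v: "v \<notin> set xs \<and> insert v (set xs) \<in> K" if "c' xs \<noteq> 0" for xs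
  proof -
    have "set xs \<notin> L" "v \<notin> set xs" "c xs \<noteq> 0" using that by (auto simp: c'_def split: if_splits)
    then show ?thesis using out[of "set xs"] chains_support(3)[OF c, of xs] by auto
  qed
  define h where "h = cone v c'"
  have h: "h \<in> simplicial_chains F K (k + 1)"
    unfolding h_def by (rule cone_chains[OF c' c'v])
  define d where "d = (\<lambda>xs. c xs - boundary h xs)"
  have dh: "boundary h \<in> simplicial_chains F K k"
    using boundary_chains[OF h K] by simp
  have d: "d \<in> simplicial_chains F K k"
    unfolding d_def by (rule chains_diff[OF c dh])
  have dd: "boundary d = boundary c"
    unfolding d_def boundary_diff[OF c dh] boundary_boundary[OF h] by simp
  \<comment> \<open>On lists without \<open>v\<close> the term \<open>cone v (boundary c')\<close>
    vanishes, so \<open>boundary h\<close> equals \<open>c'\<close> there and cancels all of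
    \<open>c\<close> outside \<open>L\<close>.\<close>
  have d_avoid: "set xs \<in> L" if "d xs \<noteq> 0" "v \<notin> set xs" for xs
  proof (rule ccontr)
    assume "set xs \<notin> L"
    moreover have "boundary h xs = c' xs - cone v (boundary c') xs"
      unfolding h_def by (rule boundary_cone[OF c']) (use c'v in blast)
    moreover have "cone v (boundary c') xs = 0"
      using cone_support[of v "boundary c'" xs] that(2) by (metis in_set_conv_decomp)
    ultimately show False using that by (simp add: d_def c'_def)
  qed
  \<comment> \<open>If \<open>d\<close> were nonzero on a simplex outside \<open>L\<close>
    containing \<open>v\<close>, its face \<open>ys\<close> opposite \<open>v\<close> would lie
    outside \<open>L\<close> by \<open>inside\<close>. Any other simplex of \<open>d\<close> over
    \<open>ys\<close> would avoid \<open>v\<close>, hence lie in \<open>L\<close> together with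
    \<open>ys\<close>. So nothing could cancel at \<open>ys\<close>, while
    \<open>boundary d = boundary c\<close> is supported in \<open>L\<close>.\<close>
  have "set xs \<in> L" if dxs: "d xs \<noteq> 0" "v \<in> set xs" for xs
  proof (rule ccontr)
    assume notL: "set xs \<notin> L"
    obtain us vs where xs: "xs = us @ v # vs" using dxs(2) by (meson split_list)
    define ys where "ys = us @ vs"
    have "d (v # ys) \<noteq> 0"
      using dxs chains_move_to_front'[OF d, of us v vs] by (simp add: xs ys_def)
    have set_xs: "set xs = insert v (set ys)" by (auto simp: xs ys_def)
    have "set xs \<in> K" using chains_support(3)[OF d dxs(1)] xs by simp
    then have ys: "set ys \<notin> L" using inside[of "set ys"] notL set_xs by auto
    have "d (x # ys) = 0" if "x \<noteq> v" for x
    proof (rule ccontr)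
      assume "d (x # ys) \<noteq> 0"
      moreover have "v \<notin> set (x # ys)"
        using that chains_support(1)[OF d \<open>d (v # ys) \<noteq> 0\<close>] by auto
      ultimately have "insert x (set ys) \<in> L" using d_avoid[of "x # ys"] by simp
      then show False using L ys by blast
    qed
    then have "boundary d ys = (\<Sum>x\<in>{v}. d (x # ys))"
      by (intro boundary_eq_sum) auto
    then have "boundary c ys \<noteq> 0" using \<open>d (v # ys) \<noteq> 0\<close> dd by simp
    then show False using dc ys by blast
  qed
  then show ?thesis using h d_avoid unfolding d_def by blast
qed

section \<open>Chains under an injection of the vertices\<close>

text \<open>The chain map induced by \<open>f\<close>. It is meant for injective \<open>f\<close>,
  where a list has at most one preimage and no sum over fibres is needed.\<close>

definition push :: "('a \<Rightarrow> 'b) \<Rightarrow> ('a list \<Rightarrow> 'f::zero) \<Rightarrow> 'b list \<Rightarrow> 'f" where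
  "push f c ys = (if set ys \<subseteq> range f then c (map (inv_into UNIV f) ys) else 0)"

lemma push_map: "inj f \<Longrightarrow> push f c (map f xs) = c xs"
  by (auto simp: push_def comp_def)

lemma push_support:
  assumes "inj f" "push f c ys \<noteq> 0"
  obtains xs where "ys = map f xs" "c xs \<noteq> 0"
proof
  have "set ys \<subseteq> range f" "c (map (inv_into UNIV f) ys) \<noteq> 0"
    using assms by (auto simp: push_def split: if_splits)
  then show "ys = map f (map (inv_into UNIV f) ys)" "c (map (inv_into UNIV f) ys) \<noteq> 0"
    by (auto simp: subset_iff f_inv_into_f intro!: map_idI[symmetric])
qed

lemma push_chains:
  fixes c :: "'a list \<Rightarrow> 'f::field"
  assumes f: "inj f" and c: "c \<in> simplicial_chains F X k"
  shows "push f c \<in> simplicial_chains F ((`) f ` X) k"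
proof (rule chainsI)
  have "{ys. push f c ys \<noteq> 0} \<subseteq> map f ` {xs. c xs \<noteq> 0}"
    using push_support[OF f] by blast
  then show "finite {ys. push f c ys \<noteq> 0}"
    using chains_finite[OF c] finite_surj by blast
next
  fix ys assume "push f c ys \<noteq> 0"
  then obtain xs where "ys = map f xs" "c xs \<noteq> 0" by (rule push_support[OF f])
  then show "distinct ys \<and> int (length ys) = k + 1 \<and> (ys = [] \<or> set ys \<in> (`) f ` X)"
    using chains_support[OF c, of xs] f by (auto simp: distinct_map inj_on_def)
next
  fix us a b vs
  show "push f c (us @ a # b # vs) = - push f c (us @ b # a # vs)"
    using chains_swap_adjacent[OF c, of "map (inv_into UNIV f) us" "inv_into UNIV f a" "inv_into UNIV f b" "map (inv_into UNIV f) vs"]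
    by (auto simp: push_def)
qed

lemma boundary_push:
  fixes c :: "'a list \<Rightarrow> 'f::field"
  assumes f: "inj f" and c: "c \<in> simplicial_chains F X k"
  shows "boundary (push f c) = push f (boundary c)"
proof
  fix ys
  have "boundary (push f c) ys = (\<Sum>y\<in>f ` vertices c. push f c (y # ys))"
  proof (rule boundary_eq_sum)
    show "finite (f ` vertices c)" using finite_vertices[OF c] by simp
    show "{y. push f c (y # ys) \<noteq> 0} \<subseteq> f ` vertices c"
    proof safe
      fix y assume "push f c (y # ys) \<noteq> 0"
      then obtain xs where "y # ys = map f xs" "c xs \<noteq> 0" by (rule push_support[OF f])
      then show "y \<in> f ` vertices c"
        using mem_vertices[of c xs "hd xs"] by (cases xs) auto
    qed
  qed
  also have "\<dots> = (\<Sum>x\<in>vertices c. push f c (f x # ys))"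
    using f by (subst sum.reindex) (auto simp: inj_on_def)
  also have "\<dots> = push f (boundary c) ys"
    using f by (auto simp: push_def boundary_eq_sum_vertices[OF c])
  finally show "boundary (push f c) ys = push f (boundary c) ys" .
qed

text \<open>Composition with \<open>map f\<close> inverts \<open>push f\<close>, as all lists in the
  support have entries in the range of \<open>f\<close>. This brings chains found in
  \<open>union_part\<close> and \<open>nerve_part\<close> back to the original complexes.\<close>

lemma ex_push:
  fixes c :: "'b list \<Rightarrow> 'f::field"
  assumes f: "inj f" and c: "c \<in> simplicial_chains F ((`) f ` X) k"
  obtains b where "b \<in> simplicial_chains F X k" "push f b = c"
proof
  define b where "b = (\<lambda>xs. c (map f xs))"
  have range: "set ys \<subseteq> range f" if "c ys \<noteq> 0" for ys
    using chains_support(3)[OF c that] by (cases ys) auto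
  show push: "push f b = c"
  proof
    fix ys
    show "push f b ys = c ys"
    proof (cases "set ys \<subseteq> range f")
      case True
      then have "map f (map (inv_into UNIV f) ys) = ys"
        by (auto simp: subset_iff f_inv_into_f intro!: map_idI)
      then show ?thesis using True by (simp add: push_def b_def)
    qed (use range[of ys] in \<open>auto simp: push_def\<close>)
  qed
  show "b \<in> simplicial_chains F X k"
  proof (rule chainsI)
    have "inj (map f)" using f by simp
    moreover have "{xs. b xs \<noteq> 0} = map f -` {ys. c ys \<noteq> 0}" by (auto simp: b_def)
    ultimately show "finite {xs. b xs \<noteq> 0}"
      using finite_vimageI[OF chains_finite[OF c]] by metis
  next
    fix xs assume "b xs \<noteq> 0"
    then have "c (map f xs) \<noteq> 0" by (simp add: b_def)
    note supp = chains_support[OF c this]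
    have "set xs \<in> X" if "xs \<noteq> []"
    proof -
      have "f ` set xs \<in> (`) f ` X" using supp(3) that by simp
      then obtain s where "s \<in> X" "f ` set xs = f ` s" by blast
      then show ?thesis using f by (simp add: inj_image_eq_iff)
    qed
    then show "distinct xs \<and> int (length xs) = k + 1 \<and> (xs = [] \<or> set xs \<in> X)"
      using supp by (auto simp: distinct_map)
  next
    show "b (us @ x # y # vs) = - b (us @ y # x # vs)" for us x y vs
      using chains_swap_adjacent[OF c, of "map f us" "f x" "f y" "map f vs"] by (simp add: b_def)
  qed
qed

lemma push_inject: "inj f \<Longrightarrow> push f c = push f d \<Longrightarrow> c = d"
  by (metis ext push_map)

lemma push_zero: "push f (\<lambda>xs. 0) = (\<lambda>ys. 0)"
  by (simp add: push_def fun_eq_iff)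

lemma push_add: "push f (\<lambda>xs. c xs + d xs) = (\<lambda>ys. push f c ys + push f d ys :: 'f::monoid_add)"
  by (simp add: push_def fun_eq_iff)

lemma push_smult: "push f (\<lambda>xs. a * c xs) = (\<lambda>ys. a * push f c ys :: 'f::field)"
  by (simp add: push_def fun_eq_iff)

section \<open>A complex containing both the union and the nerve\<close>

locale complex_family =
  fixes I :: "'i set" and \<Gamma> :: "'i \<Rightarrow> 'a set set"
  assumes finite_I: "finite I"
    and complex: "\<And>i. i \<in> I \<Longrightarrow> simplicial_complex (\<Gamma> i)"
begin

text \<open>The tags \<open>Inl\<close> and \<open>Inr\<close> keep vertices and indices apart, so
  that a join of the two kinds of simplices is a plain set.\<close>

definition union_part :: "'i set \<Rightarrow> ('a + 'i) set set" where
  "union_part t = (`) Inl ` (\<Union>i\<in>t. \<Gamma> i)"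

definition nerve_part :: "'i set \<Rightarrow> ('a + 'i) set set" where
  "nerve_part t = (`) Inr ` nerve t \<Gamma>"

text \<open>The joins of \<open>x \<in> \<Gamma> i\<close>, for some \<open>i \<in> J\<close>, with sets of indices \<open>\<tau> \<subseteq> t\<close> such that \<open>x\<close> lies in
  all \<open>\<Gamma> i\<close>, \<open>i \<in> \<tau>\<close>; together with the nerve.\<close>
definition mixed :: "'i set \<Rightarrow> 'i set \<Rightarrow> ('a + 'i) set set" where
  "mixed J t = {s. Inr -` s \<subseteq> t \<and>
     (if Inl -` s = {} then Inr -` s \<in> nerve t \<Gamma>
      else Inl -` s \<in> (\<Union>i\<in>J. \<Gamma> i) \<and> (\<forall>i\<in>Inr -` s. Inl -` s \<in> \<Gamma> i))}"

lemma complex_face: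
  "i \<in> I \<Longrightarrow> x \<in> \<Gamma> i \<Longrightarrow> y \<subseteq> x \<Longrightarrow> y \<noteq> {} \<Longrightarrow> y \<in> \<Gamma> i"
  using complex[of i] unfolding simplicial_complex_def by blast

lemma nerve_face: "\<sigma> \<in> nerve t \<Gamma> \<Longrightarrow> \<tau> \<subseteq> \<sigma> \<Longrightarrow> \<tau> \<noteq> {} \<Longrightarrow> \<tau> \<in> nerve t \<Gamma>"
  unfolding nerve_def by blast

text \<open>The delicate face is one that loses the whole \<open>Inl\<close> part of
  \<open>s\<close>. That part is a simplex common to all members indexed by the face, and thus
  witnesses that the face lies in the nerve.\<close>

lemma mixed_face:
  assumes "J \<subseteq> I" "t \<subseteq> I" "s \<in> mixed J t" "r \<subseteq> s" "r \<noteq> {}"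
  shows "r \<in> mixed J t"
proof -
  have sub: "Inr -` r \<subseteq> Inr -` s" "Inl -` r \<subseteq> Inl -` s" using assms(4) by auto
  have s: "Inr -` s \<subseteq> t" using assms(3) by (simp add: mixed_def)
  show ?thesis
  proof (cases "Inl -` r = {}")
    case True
    have "Inr -` r \<noteq> {}"
    proof -
      obtain v where "v \<in> r" using assms(5) by blast
      then show ?thesis using True by (cases v) auto
    qed
    moreover have "Inr -` r \<in> nerve t \<Gamma>"
    proof (cases "Inl -` s = {}")
      case True
      then have "Inr -` s \<in> nerve t \<Gamma>" using assms(3) by (simp add: mixed_def)
      then show ?thesis using nerve_face sub(1) \<open>Inr -` r \<noteq> {}\<close> by blast
    next
      case False
      then have "\<forall>i\<in>Inr -` s. Inl -` s \<in> \<Gamma> i" using assms(3) by (simp add: mixed_def)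
      then have "Inl -` s \<in> (\<Inter>i\<in>Inr -` r. \<Gamma> i)" using sub(1) by blast
      then show ?thesis using sub(1) s \<open>Inr -` r \<noteq> {}\<close> unfolding nerve_def by blast
    qed
    ultimately show ?thesis using True sub s by (auto simp: mixed_def)
  next
    case False
    then have "Inl -` s \<noteq> {}" using sub by blast
    then have *: "Inl -` s \<in> (\<Union>i\<in>J. \<Gamma> i)" "\<forall>i\<in>Inr -` s. Inl -` s \<in> \<Gamma> i"
      using assms(3) by (simp_all add: mixed_def)
    then have "Inl -` r \<in> (\<Union>i\<in>J. \<Gamma> i)"
      using complex_face[OF _ _ sub(2) False] assms(1) by blast
    moreover have "Inl -` r \<in> \<Gamma> i" if "i \<in> Inr -` r" for i
      using complex_face[OF _ _ sub(2) False, of i] *(2) that sub(1) s assms(2) by blast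
    ultimately show ?thesis using False sub s by (simp add: mixed_def)
  qed
qed

text \<open>The end point of removing members from \<open>J\<close>: when none is left, no simplex
  can have a nonempty \<open>Inl\<close> part.\<close>

lemma mixed_empty: "mixed {} t = nerve_part t"
proof (intro equalityI subsetI)
  fix s assume "s \<in> mixed {} t"
  then have *: "Inl -` s = {}" "Inr -` s \<in> nerve t \<Gamma>" by (auto simp: mixed_def split: if_splits)
  have "s = Inr ` (Inr -` s)"
  proof (intro equalityI subsetI)
    fix v assume "v \<in> s"
    then show "v \<in> Inr ` (Inr -` s)" using *(1) by (cases v) auto
  qed auto
  then show "s \<in> nerve_part t" unfolding nerve_part_def using *(2) by (rule image_eqI)
next
  fix s assume "s \<in> nerve_part t"
  then obtain \<sigma> where s: "s = Inr ` \<sigma>" "\<sigma> \<in> nerve t \<Gamma>" by (auto simp: nerve_part_def)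
  have "Inl -` s = {}" "Inr -` s = \<sigma>" by (auto simp: s(1))
  then show "s \<in> mixed {} t" using s(2) by (auto simp: mixed_def nerve_def)
qed

lemma mixed_mono: "J \<subseteq> J' \<Longrightarrow> t \<subseteq> t' \<Longrightarrow> mixed J t \<subseteq> mixed J' t'"
  unfolding mixed_def nerve_def by (auto split: if_splits)

lemma nerve_part_subset: "nerve_part t \<subseteq> mixed J t"
  using mixed_mono[of "{}" J t t] by (simp add: mixed_empty)

lemma union_part_subset:
  assumes "t \<subseteq> I"
  shows "union_part t \<subseteq> mixed t t"
proof
  fix s assume "s \<in> union_part t"
  then obtain i x where *: "i \<in> t" "x \<in> \<Gamma> i" "s = Inl ` x" by (auto simp: union_part_def)
  have "x \<noteq> {}" using complex[of i] * assms unfolding simplicial_complex_def by blast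
  moreover have "Inl -` s = x" "Inr -` s = {}" by (auto simp: *(3))
  ultimately show "s \<in> mixed t t" using * by (auto simp: mixed_def)
qed

lemma union_part_mono: "t \<subseteq> t' \<Longrightarrow> union_part t \<subseteq> union_part t'"
  unfolding union_part_def by blast

lemma nerve_part_face: "s \<in> nerve_part t \<Longrightarrow> r \<subseteq> s \<Longrightarrow> r \<noteq> {} \<Longrightarrow> r \<in> nerve_part t"
proof -
  assume "s \<in> nerve_part t" "r \<subseteq> s" "r \<noteq> {}"
  then obtain \<sigma> \<tau> where "\<sigma> \<in> nerve t \<Gamma>" "r = Inr ` \<tau>" "\<tau> \<subseteq> \<sigma>" "\<tau> \<noteq> {}"
    unfolding nerve_part_def by (auto elim!: subset_imageE)
  then show ?thesis using nerve_face unfolding nerve_part_def by blast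
qed

text \<open>A simplex that disappears with \<open>i\<close> has a nonempty \<open>Inl\<close> part
  lying in \<open>\<Gamma> i\<close> and in no \<open>\<Gamma> j\<close> with
  \<open>j \<in> J\<close>. This condition ignores the indices present, so such simplices are paired
  by adding or deleting \<open>Inr i\<close>.\<close>

lemma mixed_remove_index:
  fixes c :: "('a + 'i) list \<Rightarrow> 'f::field"
  assumes "J \<subseteq> t" "i \<in> t" "t \<subseteq> I"
    and c: "c \<in> simplicial_chains F (mixed (insert i J) t) k"
    and dc: "\<And>xs. boundary c xs \<noteq> 0 \<Longrightarrow> set xs \<in> insert {} (mixed J t)"
  shows "\<exists>h\<in>simplicial_chains F (mixed (insert i J) t) (k + 1).
    (\<lambda>xs. c xs - boundary h xs) \<in> simplicial_chains F (mixed J t) k"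
proof -
  have J: "J \<subseteq> I" "insert i J \<subseteq> I" using assms by auto
  have face: "s \<in> mixed (insert i J) t \<Longrightarrow> r \<subseteq> s \<Longrightarrow> r \<noteq> {} \<Longrightarrow> r \<in> mixed (insert i J) t" for r s
    by (rule mixed_face[OF J(2) assms(3)])
  have vim: "Inl -` insert (Inr i) s = Inl -` s" "Inr -` insert (Inr i) s = insert i (Inr -` s)"
    for s :: "('a + 'i) set" by auto
  \<comment> \<open>The empty simplex is counted in the smaller complex: the (-1)-chains are common
    to both and need not be removed.\<close>
  have "\<exists>h\<in>simplicial_chains F (mixed (insert i J) t) (k + 1).
    \<forall>xs. c xs - boundary h xs \<noteq> 0 \<longrightarrow> set xs \<in> insert {} (mixed J t)"
  proof (rule push_off_pairs[OF c face dc, where v = "Inr i"])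
    fix x s assume "insert x s \<in> insert {} (mixed J t)"
    then show "s \<in> insert {} (mixed J t)"
      using mixed_face[OF J(1) assms(3), of "insert x s" s] by blast
  next
    fix s assume "s \<in> insert {} (mixed (insert i J) t)" "s \<notin> insert {} (mixed J t)"
    then show "insert (Inr i) s \<in> mixed (insert i J) t"
      unfolding mixed_def using assms(2) by (auto simp: vim split: if_splits)
  next
    fix s assume "s \<in> insert {} (mixed J t)" "insert (Inr i) s \<in> mixed (insert i J) t"
    then show "insert (Inr i) s \<in> insert {} (mixed J t)"
      unfolding mixed_def by (auto simp: vim split: if_splits)
  qed
  then obtain h where h: "h \<in> simplicial_chains F (mixed (insert i J) t) (k + 1)"
    "\<And>xs. c xs - boundary h xs \<noteq> 0 \<Longrightarrow> set xs \<in> insert {} (mixed J t)" by blast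
  have "boundary h \<in> simplicial_chains F (mixed (insert i J) t) k"
    using boundary_chains[OF h(1) face] by simp
  then have "(\<lambda>xs. c xs - boundary h xs) \<in> simplicial_chains F (mixed J t) k"
    using h(2) by (intro chains_supportI[OF chains_diff[OF c]]) auto
  then show ?thesis using h(1) by blast
qed

text \<open>The members in \<open>J\<close> are removed one at a time while \<open>t\<close> stays
  fixed. Subtracting a boundary does not change \<open>boundary c\<close>, so the assumption on it
  persists, and the corrections add up.\<close>

lemma mixed_relative_acyclic:
  fixes c :: "('a + 'i) list \<Rightarrow> 'f::field"
  assumes "finite J" "J \<subseteq> t" "t \<subseteq> I"
    and "c \<in> simplicial_chains F (mixed J t) k"
    and "boundary c \<in> simplicial_chains F (nerve_part t) (k - 1)"
  shows "\<exists>h\<in>simplicial_chains F (mixed J t) (k + 1).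
    (\<lambda>xs. c xs - boundary h xs) \<in> simplicial_chains F (nerve_part t) k"
  using assms
proof (induction J arbitrary: c rule: finite_induct)
  case empty
  then show ?case
    by (intro bexI[OF _ chains_zero]) (simp add: mixed_empty boundary_zero)
next
  case (insert i J)
  have dc: "set xs \<in> insert {} (mixed J t)" if "boundary c xs \<noteq> 0" for xs
    using chains_support(3)[OF insert.prems(4) that] nerve_part_subset by (cases xs) auto
  obtain h where h: "h \<in> simplicial_chains F (mixed (insert i J) t) (k + 1)"
    "(\<lambda>xs. c xs - boundary h xs) \<in> simplicial_chains F (mixed J t) k"
    using mixed_remove_index[OF _ _ insert.prems(2,3) dc] insert.prems(1) by blast
  have J: "insert i J \<subseteq> I" "J \<subseteq> t" using insert.prems by auto
  have dh: "boundary h \<in> simplicial_chains F (mixed (insert i J) t) k"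
    using boundary_chains[OF h(1)] mixed_face[OF J(1) insert.prems(2)] by fastforce
  have "boundary (\<lambda>xs. c xs - boundary h xs) = boundary c"
    by (simp add: boundary_diff[OF insert.prems(3) dh] boundary_boundary[OF h(1)])
  then obtain g where g: "g \<in> simplicial_chains F (mixed J t) (k + 1)"
    "(\<lambda>xs. c xs - boundary h xs - boundary g xs) \<in> simplicial_chains F (nerve_part t) k"
    using insert.IH[OF J(2) insert.prems(2) h(2)] insert.prems(4) by auto
  have g': "g \<in> simplicial_chains F (mixed (insert i J) t) (k + 1)"
    using chains_mono[OF g(1) mixed_mono] by blast
  show ?case
    using chains_add[OF h(1) g'] g(2)
    by (intro bexI[of _ "\<lambda>xs. h xs + g xs"]) (simp_all add: boundary_add[OF h(1) g'] diff_diff_eq)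
qed

text \<open>Since \<open>t\<close> itself is in the nerve, \<open>nerve_part t\<close> is a full
  simplex. Here the set to be kept is empty, so the empty simplex is paired as well, with the vertex
  \<open>Inr i\<close>; this makes the vanishing a statement about reduced homology.\<close>

lemma simplex_acyclic:
  fixes c :: "('a + 'i) list \<Rightarrow> 'f::field"
  assumes t: "t \<in> nerve I \<Gamma>"
    and c: "c \<in> simplicial_chains F (nerve_part t) k" "boundary c = (\<lambda>xs. 0)"
  shows "\<exists>h\<in>simplicial_chains F (nerve_part t) (k + 1). boundary h = c"
proof -
  obtain i where i: "i \<in> t" using t by (auto simp: nerve_def)
  have "\<exists>h\<in>simplicial_chains F (nerve_part t) (k + 1).
    \<forall>xs. c xs - boundary h xs \<noteq> 0 \<longrightarrow> set xs \<in> {}"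
  proof (rule push_off_pairs[OF c(1) nerve_part_face, where v = "Inr i"])
    fix s assume "s \<in> insert {} (nerve_part t)"
    then obtain \<sigma> where "s = Inr ` \<sigma>" "\<sigma> \<subseteq> t" by (auto simp: nerve_part_def nerve_def)
    moreover have "insert i \<sigma> \<in> nerve t \<Gamma>" if "\<sigma> \<subseteq> t" for \<sigma>
      using t i that unfolding nerve_def by blast
    ultimately have "insert i \<sigma> \<in> nerve t \<Gamma>" "insert (Inr i) s = Inr ` insert i \<sigma>" by auto
    then show "insert (Inr i) s \<in> nerve_part t" unfolding nerve_part_def by blast
  qed (use c(2) in auto)
  then show ?thesis by (auto simp: fun_eq_iff)
qed

text \<open>Relative acyclicity moves the cycle into the full simplex on \<open>t\<close>, where it
  bounds. Thus \<open>mixed t t\<close> can serve as acyclic carrier of the simplex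
  \<open>t\<close>.\<close>

lemma mixed_acyclic:
  fixes c :: "('a + 'i) list \<Rightarrow> 'f::field"
  assumes t: "t \<in> nerve I \<Gamma>"
    and c: "c \<in> simplicial_chains F (mixed t t) k" "boundary c = (\<lambda>xs. 0)"
  shows "\<exists>h\<in>simplicial_chains F (mixed t t) (k + 1). boundary h = c"
proof -
  have tI: "t \<subseteq> I" using t by (simp add: nerve_def)
  then have "finite t" using finite_I finite_subset by blast
  then obtain h where h: "h \<in> simplicial_chains F (mixed t t) (k + 1)"
    "(\<lambda>xs. c xs - boundary h xs) \<in> simplicial_chains F (nerve_part t) k"
    using mixed_relative_acyclic[of t t c F k] tI c by (auto simp: chains_zero)
  have dh: "boundary h \<in> simplicial_chains F (mixed t t) k"
    using boundary_chains[OF h(1)] mixed_face[OF tI tI] by fastforce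
  have "boundary (\<lambda>xs. c xs - boundary h xs) = (\<lambda>xs. 0)"
    by (simp add: boundary_diff[OF c(1) dh] boundary_boundary[OF h(1)] c(2))
  then obtain g where g: "g \<in> simplicial_chains F (nerve_part t) (k + 1)"
    "boundary g = (\<lambda>xs. c xs - boundary h xs)"
    using simplex_acyclic[OF t h(2)] by blast
  have g': "g \<in> simplicial_chains F (mixed t t) (k + 1)"
    by (rule chains_mono[OF g(1) nerve_part_subset])
  show ?thesis
    using chains_add[OF h(1) g']
    by (intro bexI[of _ "\<lambda>xs. h xs + g xs"]) (simp_all add: boundary_add[OF h(1) g'] g(2))
qed

end

section \<open>Decomposition of a chain into oriented simplices\<close>

text \<open>Linearity in the form in which it is applied: the index set consists of simplices,
  because a quantifier inside the formula cannot range over types.\<close>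

definition linear_comb_preserving :: "(('a list \<Rightarrow> 'f::field) \<Rightarrow> ('b list \<Rightarrow> 'f)) \<Rightarrow> bool" where
  "linear_comb_preserving \<Phi> \<longleftrightarrow> (\<forall>(S::'a set set) a e. finite S \<longrightarrow>
     \<Phi> (\<lambda>xs. \<Sum>s\<in>S. a s * e s xs) = (\<lambda>xs. \<Sum>s\<in>S. a s * \<Phi> (e s) xs))"

lemma linear_comb_preservingD:
  fixes \<Phi> :: "('a list \<Rightarrow> 'f::field) \<Rightarrow> ('b list \<Rightarrow> 'f)" and S :: "'a set set"
  assumes "linear_comb_preserving \<Phi>" "finite S"
  shows "\<Phi> (\<lambda>xs. \<Sum>s\<in>S. a s * e s xs) = (\<lambda>xs. \<Sum>s\<in>S. a s * \<Phi> (e s) xs)"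
  using assms(1)[unfolded linear_comb_preserving_def, rule_format, OF assms(2)] .

definition vertex_order :: "'a set \<Rightarrow> 'a list" where
  "vertex_order s = (SOME xs. distinct xs \<and> set xs = s)"

text \<open>Only meaningful when some \<open>k\<close>-chain is nonzero on \<open>s\<close>; the other simplices have coefficient
  \<open>0\<close> in every chain.\<close>
definition generator :: "'f::field itself \<Rightarrow> int \<Rightarrow> 'a set \<Rightarrow> 'a list \<Rightarrow> 'f" where
  "generator F k s = (SOME e. e \<in> simplicial_chains F {s} k \<and> e (vertex_order s) = 1)"

lemma vertex_order: "finite s \<Longrightarrow> distinct (vertex_order s) \<and> set (vertex_order s) = s"
  unfolding vertex_order_def by (rule someI_ex) (use finite_distinct_list in blast)

text \<open>Restricting to \<open>s\<close> a chain that is nonzero there, and scaling, yields the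
  oriented simplex without a formula for the signs of its orderings.\<close>

lemma generator:
  fixes c :: "'a list \<Rightarrow> 'f::field"
  assumes c: "c \<in> simplicial_chains F X k" "c (vertex_order s) \<noteq> 0" and s: "finite s" "s \<noteq> {}"
  shows "generator F k s \<in> simplicial_chains F {s} k" "generator F k s (vertex_order s) = 1"
proof -
  define e where "e = (\<lambda>xs. 1 / c (vertex_order s) * (if set xs = s then c xs else 0))"
  have "e \<in> simplicial_chains F X k"
    unfolding e_def by (intro chains_smult chains_restrict c)
  then have "e \<in> simplicial_chains F {s} k"
    by (rule chains_supportI) (auto simp: e_def split: if_splits)
  moreover have "e (vertex_order s) = 1" using vertex_order[OF s(1)] c(2) by (simp add: e_def)
  ultimately have "\<exists>e. e \<in> simplicial_chains F {s} k \<and> e (vertex_order s) = 1" by blast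
  then have "generator F k s \<in> simplicial_chains F {s} k \<and> generator F k s (vertex_order s) = 1"
    unfolding generator_def by (rule someI_ex)
  then show "generator F k s \<in> simplicial_chains F {s} k" "generator F k s (vertex_order s) = 1"
    by auto
qed

text \<open>Both sides alternate, so on each simplex they agree once they agree at the reference
  ordering. Degree -1 is excluded because \<open>[]\<close> spans no member of
  \<open>X\<close>.\<close>

lemma chain_eq_sum_generators:
  fixes c :: "'a list \<Rightarrow> 'f::field"
  assumes c: "c \<in> simplicial_chains F X k" and k: "k \<noteq> - 1"
    and X: "\<And>s. s \<in> X \<Longrightarrow> finite s \<and> s \<noteq> {}" "finite X"
  shows "c = (\<lambda>xs. \<Sum>s\<in>X. c (vertex_order s) * generator F k s xs)"
proof
  fix xs
  have zero: "c (vertex_order s) * generator F k s xs = 0" if "s \<in> X" "s \<noteq> set xs" for s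
  proof (cases "c (vertex_order s) = 0")
    case False
    have gen: "generator F k s \<in> simplicial_chains F {s} k"
      using generator(1)[OF c False] X(1)[OF that(1)] by blast
    have "generator F k s xs = 0"
    proof (rule ccontr)
      assume "generator F k s xs \<noteq> 0"
      from chains_support[OF gen this] show False using that k by (cases xs) auto
    qed
    then show ?thesis by simp
  qed simp
  show "c xs = (\<Sum>s\<in>X. c (vertex_order s) * generator F k s xs)"
  proof (cases "set xs \<in> X \<and> distinct xs")
    case True
    let ?s = "set xs"
    have ord: "distinct (vertex_order ?s)" "set (vertex_order ?s) = ?s"
      using vertex_order[of ?s] by auto
    have "(\<Sum>s\<in>X. c (vertex_order s) * generator F k s xs) =
      (\<Sum>s\<in>{?s}. c (vertex_order s) * generator F k s xs)"
      by (rule sum.mono_neutral_right) (use X(2) True zero in auto)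
    also have "\<dots> = c xs"
    proof (cases "c (vertex_order ?s) = 0")
      case zero: True
      then show ?thesis
        using chains_same_simplex[OF c c ord(1), of xs] True ord(2) by auto
    next
      case False
      have "set xs \<noteq> {}" using X(1) True by blast
      note gen = generator[OF c False _ this]
      then show ?thesis
        using chains_same_simplex[OF c gen(1) ord(1), of xs] gen(2) True ord(2) by auto
    qed
    finally show ?thesis by simp
  next
    case False
    have "c xs = 0"
    proof (rule ccontr)
      assume "c xs \<noteq> 0"
      from chains_support[OF c this] show False using False k by (cases xs) auto
    qed
    moreover have "c (vertex_order s) * generator F k s xs = 0" if "s \<in> X" for s
    proof (rule ccontr)
      assume *: "c (vertex_order s) * generator F k s xs \<noteq> 0"
      then have "generator F k s \<in> simplicial_chains F {s} k"
        using generator(1)[OF c] X(1)[OF that] by auto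
      moreover have "generator F k s xs \<noteq> 0" using * by simp
      ultimately show False using chains_support[of "generator F k s" F "{s}" k xs] False k that
        by (cases xs) auto
    qed
    ultimately show ?thesis by simp
  qed
qed

section \<open>Deforming cycles of the nerve into the union\<close>

context complex_family
begin

lemma finite_nerve: "finite (nerve I \<Gamma>)"
  unfolding nerve_def using finite_I by simp

lemma nerve_part_mono: "t \<subseteq> t' \<Longrightarrow> nerve_part t \<subseteq> nerve_part t'"
  using mixed_mono[of "{}" "{}" t t'] by (simp add: mixed_empty)

lemma union_part_acyclic:
  fixes c :: "('a + 'i) list \<Rightarrow> 'f::field"
  assumes acyclic: "\<And>b. b \<in> simplicial_chains F (\<Union>i\<in>t. \<Gamma> i) k \<Longrightarrow> boundary b = (\<lambda>xs. 0) \<Longrightarrow>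
      \<exists>h\<in>simplicial_chains F (\<Union>i\<in>t. \<Gamma> i) (k + 1). boundary h = b"
    and c: "c \<in> simplicial_chains F (union_part t) k" "boundary c = (\<lambda>xs. 0)"
  shows "\<exists>h\<in>simplicial_chains F (union_part t) (k + 1). boundary h = c"
proof -
  have inj: "inj (Inl :: 'a \<Rightarrow> 'a + 'i)" by simp
  obtain b where b: "b \<in> simplicial_chains F (\<Union>i\<in>t. \<Gamma> i) k" "push Inl b = c"
    using ex_push[OF inj, of c F "\<Union>i\<in>t. \<Gamma> i" k] c(1) unfolding union_part_def by blast
  have "push Inl (boundary b) = push (Inl :: 'a \<Rightarrow> 'a + 'i) (\<lambda>xs. 0)"
    using boundary_push[OF inj b(1)] b(2) c(2) by (simp add: push_zero)
  then have "boundary b = (\<lambda>xs. 0)" by (rule push_inject[OF inj])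
  then obtain h where h: "h \<in> simplicial_chains F (\<Union>i\<in>t. \<Gamma> i) (k + 1)" "boundary h = b"
    using acyclic[OF b(1)] by blast
  have "push Inl h \<in> simplicial_chains F (union_part t) (k + 1)"
    unfolding union_part_def by (rule push_chains[OF inj h(1)])
  moreover have "boundary (push Inl h) = c" using boundary_push[OF inj h(1)] h(2) b(2) by simp
  ultimately show ?thesis by blast
qed

text \<open>One step of the deformation, with \<open>w\<close> the deformation already chosen for
  \<open>boundary e\<close>. The cycle \<open>boundary e - boundary w\<close> lies in the union over
  \<open>t\<close> and is filled there by some \<open>v\<close>; then \<open>e - w - v\<close> is a
  cycle of the acyclic complex \<open>mixed t t\<close> and equals some
  \<open>boundary h\<close>.\<close>

lemma generator_filling:
  fixes e :: "('a + 'i) list \<Rightarrow> 'f::field"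
  assumes t: "t \<in> nerve I \<Gamma>"
    and e: "e \<in> simplicial_chains F (nerve_part t) k"
    and w: "w \<in> simplicial_chains F (mixed t t) k"
    and u: "(\<lambda>xs. boundary e xs - boundary w xs) \<in> simplicial_chains F (union_part t) (k - 1)"
    and acyclic: "\<And>b. b \<in> simplicial_chains F (\<Union>i\<in>t. \<Gamma> i) (k - 1) \<Longrightarrow> boundary b = (\<lambda>xs. 0) \<Longrightarrow>
      \<exists>h\<in>simplicial_chains F (\<Union>i\<in>t. \<Gamma> i) k. boundary h = b"
  shows "\<exists>h v. h \<in> simplicial_chains F (mixed t t) (k + 1) \<and>
    v \<in> simplicial_chains F (union_part t) k \<and> (\<forall>xs. e xs - boundary h xs = w xs + v xs)"
proof -
  have tI: "t \<subseteq> I" using t by (simp add: nerve_def)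
  have de: "boundary e \<in> simplicial_chains F (nerve_part t) (k - 1)"
    using boundary_chains[OF e nerve_part_face] .
  have dw: "boundary w \<in> simplicial_chains F (mixed t t) (k - 1)"
    using boundary_chains[OF w] mixed_face[OF tI tI] by fastforce
  have "boundary (\<lambda>xs. boundary e xs - boundary w xs) = (\<lambda>xs. 0)"
    by (simp add: boundary_diff[OF de dw] boundary_boundary[OF e] boundary_boundary[OF w])
  then obtain v where v: "v \<in> simplicial_chains F (union_part t) k"
    "boundary v = (\<lambda>xs. boundary e xs - boundary w xs)"
    using union_part_acyclic[OF _ u] acyclic by auto
  have e': "e \<in> simplicial_chains F (mixed t t) k" by (rule chains_mono[OF e nerve_part_subset])
  have v': "v \<in> simplicial_chains F (mixed t t) k"
    by (rule chains_mono[OF v(1) union_part_subset[OF tI]])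
  have ew: "(\<lambda>xs. e xs - w xs) \<in> simplicial_chains F (mixed t t) k" by (rule chains_diff[OF e' w])
  have "boundary (\<lambda>xs. e xs - w xs - v xs) = (\<lambda>xs. 0)"
    unfolding boundary_diff[OF ew v'] boundary_diff[OF e' w] v(2) by simp
  then obtain h where h: "h \<in> simplicial_chains F (mixed t t) (k + 1)"
    "boundary h = (\<lambda>xs. e xs - w xs - v xs)"
    using mixed_acyclic[OF t chains_diff[OF ew v']] by blast
  show ?thesis using h v(1) by (intro exI[of _ h] exI[of _ v]) simp
qed

text \<open>An acyclic carrier argument. The control over all \<open>t\<close> is what the induction needs, applied to the
  boundary of the simplex \<open>t\<close>; linearity makes these choices cancel on a cycle.\<close>
lemma ex_deformation:
  fixes F :: "'f::field itself"
  assumes acyclic: "\<And>\<sigma> b. \<sigma> \<in> nerve I \<Gamma> \<Longrightarrow> int (card \<sigma>) - 1 \<le> l \<Longrightarrow>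
      b \<in> simplicial_chains F (\<Union>i\<in>\<sigma>. \<Gamma> i) (int (card \<sigma>) - 2) \<Longrightarrow> boundary b = (\<lambda>xs. 0) \<Longrightarrow>
      \<exists>h\<in>simplicial_chains F (\<Union>i\<in>\<sigma>. \<Gamma> i) (int (card \<sigma>) - 1). boundary h = b"
    and "int n \<le> l + 1"
  shows "\<exists>\<Phi>::(('a + 'i) list \<Rightarrow> 'f) \<Rightarrow> (('a + 'i) list \<Rightarrow> 'f). linear_comb_preserving \<Phi> \<and>
    (\<forall>t z. t \<subseteq> I \<longrightarrow> z \<in> simplicial_chains F (nerve_part t) (int n - 1) \<longrightarrow> boundary z = (\<lambda>xs. 0) \<longrightarrow>
      \<Phi> z \<in> simplicial_chains F (mixed t t) (int n) \<and>
      (\<lambda>xs. z xs - boundary (\<Phi> z) xs) \<in> simplicial_chains F (union_part t) (int n - 1))"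
  using assms(2)
proof (induction n)
  case 0
  \<comment> \<open>A (-1)-chain lives on \<open>[]\<close> and so already belongs to the union
    part; the zero operator suffices.\<close>
  have "z \<in> simplicial_chains F (union_part t) (- 1)"
    if "z \<in> simplicial_chains F (nerve_part t) (- 1)" for z :: "('a + 'i) list \<Rightarrow> 'f" and t
    by (rule chains_supportI[OF that]) (use chains_support(2)[OF that] in auto)
  then show ?case
    by (intro exI[of _ "\<lambda>z xs. 0"])
      (auto simp: linear_comb_preserving_def chains_zero boundary_zero)
next
  case (Suc n)
  then obtain \<Phi> :: "(('a + 'i) list \<Rightarrow> 'f) \<Rightarrow> (('a + 'i) list \<Rightarrow> 'f)" where
    lin: "linear_comb_preserving \<Phi>" and
    \<Phi>: "\<And>t z. t \<subseteq> I \<Longrightarrow> z \<in> simplicial_chains F (nerve_part t) (int n - 1) \<Longrightarrow>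
      boundary z = (\<lambda>xs. 0) \<Longrightarrow> \<Phi> z \<in> simplicial_chains F (mixed t t) (int n) \<and>
      (\<lambda>xs. z xs - boundary (\<Phi> z) xs) \<in> simplicial_chains F (union_part t) (int n - 1)"
    by auto
  let ?k = "int n" and ?N = "nerve_part I"
  let ?e = "generator F ?k :: ('a + 'i) set \<Rightarrow> ('a + 'i) list \<Rightarrow> 'f"
  have N: "finite s \<and> s \<noteq> {}" if "s \<in> ?N" for s
    using that finite_I finite_subset by (auto simp: nerve_part_def nerve_def)
  have finN: "finite ?N" unfolding nerve_part_def using finite_nerve by simp
  \<comment> \<open>The simplices with a nonzero chain of degree \<open>?k\<close>, on which
    \<open>generator\<close> is meaningful. The set depends neither on a cycle nor on
    \<open>t\<close>.\<close>
  define S where "S = {s \<in> ?N. \<exists>z\<in>simplicial_chains F ?N ?k. z (vertex_order s) \<noteq> 0}"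
  have finS: "finite S" using finN by (simp add: S_def)
  have vimage_S: "Inr -` s \<in> nerve I \<Gamma>" "Inr ` (Inr -` s) = s" if "s \<in> S" for s
  proof -
    obtain \<sigma> where "s = Inr ` \<sigma>" "\<sigma> \<in> nerve I \<Gamma>" using \<open>s \<in> S\<close> by (auto simp: S_def nerve_part_def)
    moreover have "Inr -` (Inr ` \<sigma> :: ('a + 'i) set) = \<sigma>" by auto
    ultimately show "Inr -` s \<in> nerve I \<Gamma>" "Inr ` (Inr -` s) = s" by simp_all
  qed
  have gen: "?e s \<in> simplicial_chains F (nerve_part (Inr -` s)) ?k"
    "int (card (Inr -` s)) = ?k + 1" if sS: "s \<in> S" for s
  proof -
    obtain z where z: "z \<in> simplicial_chains F ?N ?k" "z (vertex_order s) \<noteq> 0" and s: "s \<in> ?N"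
      using sS by (auto simp: S_def)
    have "?e s \<in> simplicial_chains F {s} ?k" using generator(1)[OF z] N[OF s] by blast
    moreover have "{s} \<subseteq> nerve_part (Inr -` s)"
      using vimage_S[OF sS] unfolding nerve_part_def nerve_def by blast
    ultimately show "?e s \<in> simplicial_chains F (nerve_part (Inr -` s)) ?k"
      by (rule chains_mono)
    have "card s = n + 1"
      using chains_support(2)[OF z] vertex_order[of s] N[OF s] distinct_card[of "vertex_order s"]
      by simp
    moreover have "card s = card (Inr -` s)"
      by (subst vimage_S(2)[OF sS, symmetric]) (rule card_image, simp)
    ultimately show "int (card (Inr -` s)) = ?k + 1" by simp
  qed
  have "\<exists>h v. h \<in> simplicial_chains F (mixed (Inr -` s) (Inr -` s)) (?k + 1) \<and>
    v \<in> simplicial_chains F (union_part (Inr -` s)) ?k \<and>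
    (\<forall>xs. ?e s xs - boundary h xs = \<Phi> (boundary (?e s)) xs + v xs)" if s: "s \<in> S" for s
  proof (rule generator_filling[OF vimage_S(1)[OF s] gen(1)[OF s]])
    have tI: "Inr -` s \<subseteq> I" using vimage_S(1)[OF s] by (simp add: nerve_def)
    have "boundary (?e s) \<in> simplicial_chains F (nerve_part (Inr -` s)) (?k - 1)"
      by (rule boundary_chains[OF gen(1)[OF s] nerve_part_face])
    from \<Phi>[OF tI this boundary_boundary[OF gen(1)[OF s]]]
    show "\<Phi> (boundary (?e s)) \<in> simplicial_chains F (mixed (Inr -` s) (Inr -` s)) ?k"
      "(\<lambda>xs. boundary (?e s) xs - boundary (\<Phi> (boundary (?e s))) xs)
        \<in> simplicial_chains F (union_part (Inr -` s)) (?k - 1)" by auto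
    show "\<exists>h\<in>simplicial_chains F (\<Union>i\<in>Inr -` s. \<Gamma> i) ?k. boundary h = b"
      \<comment> \<open>The simplex has \<open>?k + 1\<close> vertices, so the degree
        \<open>card - 2\<close> of the hypothesis is \<open>?k - 1\<close>, and
        \<open>Suc n \<le> l + 1\<close> says that its dimension is at most
        \<open>l\<close>.\<close>
      if "b \<in> simplicial_chains F (\<Union>i\<in>Inr -` s. \<Gamma> i) (?k - 1)" "boundary b = (\<lambda>xs. 0)" for b
      using acyclic[OF vimage_S(1)[OF s], of b] that gen(2)[OF s] Suc.prems by simp
  qed
  then obtain H V where HV: "\<And>s. s \<in> S \<Longrightarrow>
      H s \<in> simplicial_chains F (mixed (Inr -` s) (Inr -` s)) (?k + 1) \<and>
      V s \<in> simplicial_chains F (union_part (Inr -` s)) ?k \<and>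
      (\<forall>xs. ?e s xs - boundary (H s) xs = \<Phi> (boundary (?e s)) xs + V s xs)"
    by metis
  \<comment> \<open>The fillings \<open>H s\<close> are chosen once for each simplex, before any
    cycle is given; extending them by coefficients makes the operator linear.\<close>
  define \<Psi> where "\<Psi> z = (\<lambda>xs. \<Sum>s\<in>S. z (vertex_order s) * H s xs)" for z :: "('a + 'i) list \<Rightarrow> 'f"
  have "linear_comb_preserving \<Psi>"
    unfolding linear_comb_preserving_def
  proof (intro allI impI ext)
    fix T :: "('a + 'i) set set" and a :: "('a + 'i) set \<Rightarrow> 'f" and e and xs
    have "\<Psi> (\<lambda>xs. \<Sum>s\<in>T. a s * e s xs) xs =
      (\<Sum>s\<in>S. \<Sum>r\<in>T. a r * (e r (vertex_order s) * H s xs))"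
      by (simp add: \<Psi>_def sum_distrib_right mult.assoc)
    also have "\<dots> = (\<Sum>r\<in>T. a r * \<Psi> (e r) xs)"
      by (subst sum.swap) (simp add: \<Psi>_def sum_distrib_left)
    finally show "\<Psi> (\<lambda>xs. \<Sum>s\<in>T. a s * e s xs) xs = (\<Sum>r\<in>T. a r * \<Psi> (e r) xs)" .
  qed
  moreover have "\<Psi> z \<in> simplicial_chains F (mixed t t) (?k + 1) \<and>
      (\<lambda>xs. z xs - boundary (\<Psi> z) xs) \<in> simplicial_chains F (union_part t) ?k"
    if tI: "t \<subseteq> I" and z: "z \<in> simplicial_chains F (nerve_part t) ?k" "boundary z = (\<lambda>xs. 0)" for t z
  proof -
    have zN: "z \<in> simplicial_chains F ?N ?k" by (rule chains_mono[OF z(1) nerve_part_mono[OF tI]])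
    \<comment> \<open>Only simplices of \<open>nerve_part t\<close> occur in \<open>z\<close>, so
      all carriers that contribute are contained in those of \<open>t\<close>.\<close>
    have sub: "Inr -` s \<subseteq> t" if s: "s \<in> S" "z (vertex_order s) \<noteq> 0" for s
    proof -
      have "finite s" "s \<noteq> {}" using N s(1) by (auto simp: S_def)
      then have "s \<in> nerve_part t"
        using chains_support(3)[OF z(1) s(2)] vertex_order[of s] by (metis set_empty)
      then show ?thesis by (auto simp: nerve_part_def nerve_def)
    qed
    have in_mixed: "(\<lambda>xs. z (vertex_order s) * H s xs) \<in> simplicial_chains F (mixed t t) (?k + 1)"
      if s: "s \<in> S" for s
    proof (cases "z (vertex_order s) = 0")
      case False
      have "H s \<in> simplicial_chains F (mixed t t) (?k + 1)"
        using HV[OF s] chains_mono mixed_mono[OF sub[OF s False] sub[OF s False]] by blast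
      then show ?thesis by (rule chains_smult)
    qed (simp add: chains_zero)
    have in_union: "(\<lambda>xs. z (vertex_order s) * V s xs) \<in> simplicial_chains F (union_part t) ?k"
      if s: "s \<in> S" for s
    proof (cases "z (vertex_order s) = 0")
      case False
      have "V s \<in> simplicial_chains F (union_part t) ?k"
        using HV[OF s] chains_mono union_part_mono[OF sub[OF s False]] by blast
      then show ?thesis by (rule chains_smult)
    qed (simp add: chains_zero)
    have z_sum: "z = (\<lambda>xs. \<Sum>s\<in>S. z (vertex_order s) * ?e s xs)"
    proof -
      have "(\<Sum>s\<in>?N. z (vertex_order s) * ?e s xs) = (\<Sum>s\<in>S. z (vertex_order s) * ?e s xs)" for xs
        by (rule sum.mono_neutral_right) (use finN zN in \<open>auto simp: S_def\<close>)
      then show ?thesis using chain_eq_sum_generators[OF zN _ N finN] by simp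
    qed
    have "boundary z = boundary (\<lambda>xs. \<Sum>s\<in>S. z (vertex_order s) * ?e s xs)"
      using z_sum by (rule arg_cong)
    also have "\<dots> = (\<lambda>xs. \<Sum>s\<in>S. z (vertex_order s) * boundary (?e s) xs)"
    proof (subst boundary_sum)
      show "(\<lambda>xs. z (vertex_order s) * ?e s xs) \<in> simplicial_chains F ?N ?k" if "s \<in> S" for s
        using chains_mono[OF gen(1)[OF that] nerve_part_mono[of "Inr -` s" I]] vimage_S(1)[OF that]
        by (intro chains_smult) (auto simp: nerve_def)
    qed (simp add: boundary_smult)
    finally have dz: "(\<lambda>xs. \<Sum>s\<in>S. z (vertex_order s) * boundary (?e s) xs) = (\<lambda>xs. 0)"
      using z(2) by simp
    \<comment> \<open>By linearity the lower-dimensional deformations add up to the value of \<Phi>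
      at \<open>boundary z = 0\<close>, so only the chains \<open>V s\<close> in the union
      remain.\<close>
    have "(\<lambda>xs. \<Sum>s\<in>S. z (vertex_order s) * \<Phi> (boundary (?e s)) xs) = \<Phi> (\<lambda>xs. 0)"
      unfolding dz[symmetric] by (rule linear_comb_preservingD[OF lin finS, symmetric])
    moreover have "\<Phi> (\<lambda>xs. 0) = (\<lambda>xs. 0)"
      using linear_comb_preservingD[OF lin finite.emptyI, of "\<lambda>s. 0" "\<lambda>s xs. 0"] by simp
    ultimately have \<Phi>0: "(\<Sum>s\<in>S. z (vertex_order s) * \<Phi> (boundary (?e s)) xs) = 0" for xs
      by (simp add: fun_eq_iff)
    have "z xs - boundary (\<Psi> z) xs = (\<Sum>s\<in>S. z (vertex_order s) * V s xs)" for xs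
    proof -
      have "boundary (\<Psi> z) xs = (\<Sum>s\<in>S. z (vertex_order s) * boundary (H s) xs)"
        unfolding \<Psi>_def by (subst boundary_sum[OF in_mixed]) (auto simp: boundary_smult)
      moreover have "z xs = (\<Sum>s\<in>S. z (vertex_order s) * ?e s xs)"
        using z_sum by (rule fun_cong)
      ultimately have "z xs - boundary (\<Psi> z) xs =
        (\<Sum>s\<in>S. z (vertex_order s) * (?e s xs - boundary (H s) xs))"
        by (simp add: right_diff_distrib sum_subtractf)
      also have "\<dots> = (\<Sum>s\<in>S. z (vertex_order s) * \<Phi> (boundary (?e s)) xs + z (vertex_order s) * V s xs)"
        using HV by (intro sum.cong) (auto simp: distrib_left)
      finally show ?thesis by (simp add: sum.distrib \<Phi>0)
    qed
    then have "(\<lambda>xs. z xs - boundary (\<Psi> z) xs) = (\<lambda>xs. \<Sum>s\<in>S. z (vertex_order s) * V s xs)"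
      by (rule ext)
    moreover have "\<Psi> z \<in> simplicial_chains F (mixed t t) (?k + 1)"
      unfolding \<Psi>_def by (rule chains_sum) (rule in_mixed)
    moreover have "(\<lambda>xs. \<Sum>s\<in>S. z (vertex_order s) * V s xs) \<in> simplicial_chains F (union_part t) ?k"
      by (rule chains_sum) (rule in_union)
    ultimately show ?thesis by simp
  qed
  moreover have "int (Suc n) - 1 = ?k" "int (Suc n) = ?k + 1" by simp_all
  ultimately show ?case
    by - (rule exI[of _ \<Psi>], simp only:, blast)
qed

end

section \<open>Dimensions of quotients\<close>

definition linear_closed :: "('b \<Rightarrow> 'f::field) set \<Rightarrow> bool" where
  "linear_closed C \<longleftrightarrow> (\<lambda>x. 0) \<in> C \<and> (\<forall>c\<in>C. \<forall>d\<in>C. (\<lambda>x. c x + d x) \<in> C) \<and>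
     (\<forall>a. \<forall>c\<in>C. (\<lambda>x. a * c x) \<in> C)"

text \<open>The record of \<open>chain_space\<close> with an arbitrary carrier, so that quotients
  can be handled without reference to chains.\<close>

definition function_space :: "('b \<Rightarrow> 'f::field) set \<Rightarrow> ('f, 'b \<Rightarrow> 'f) module" where
  "function_space C = \<lparr>carrier = C, mult = undefined, one = undefined,
     zero = (\<lambda>x. 0), add = (\<lambda>c d x. c x + d x), smult = (\<lambda>a c x. a * c x)\<rparr>"

definition translate :: "('b \<Rightarrow> 'f::field) set \<Rightarrow> ('b \<Rightarrow> 'f) \<Rightarrow> ('b \<Rightarrow> 'f) set" where
  "translate U c = (\<lambda>u x. u x + c x) ` U"

lemma
  assumes "linear_closed C"
  shows linear_closed_zero: "(\<lambda>x. 0) \<in> C"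
    and linear_closed_add: "c \<in> C \<Longrightarrow> d \<in> C \<Longrightarrow> (\<lambda>x. c x + d x) \<in> C"
    and linear_closed_smult: "c \<in> C \<Longrightarrow> (\<lambda>x. a * c x) \<in> C"
  using assms by (simp_all add: linear_closed_def)

lemma translateI: "u \<in> U \<Longrightarrow> e = (\<lambda>x. u x + c x) \<Longrightarrow> e \<in> translate U c"
  unfolding translate_def by (rule rev_image_eqI)

lemma linear_closed_uminus: "linear_closed C \<Longrightarrow> c \<in> C \<Longrightarrow> (\<lambda>x. - c x) \<in> C"
  using linear_closed_smult[of C c "- 1"] by simp

lemma carrier_quotient: "carrier (quotient_space (function_space C) U) = translate U ` C"
  by (auto simp: quotient_space_def A_RCOSETS_defs a_r_coset_def r_coset_def function_space_def translate_def)

lemma zero_quotient: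
  "\<zero>\<^bsub>quotient_space (function_space C) U\<^esub> = translate U (\<lambda>x. 0)"
  by (simp add: quotient_space_def translate_def)

lemma add_quotient:
  assumes "linear_closed U"
  shows "translate U c \<oplus>\<^bsub>quotient_space (function_space C) U\<^esub> translate U d = translate U (\<lambda>x. c x + d x)"
proof -
  have "(\<Union>e\<in>translate U c. \<Union>g\<in>translate U d. {\<lambda>x. e x + g x}) = translate U (\<lambda>x. c x + d x)"
    (is "?L = ?R")
  proof (intro equalityI subsetI)
    fix e assume "e \<in> ?L"
    then obtain u u' where u: "u \<in> U" "u' \<in> U" "e = (\<lambda>x. (u x + c x) + (u' x + d x))"
      by (auto simp: translate_def)
    then have "e = (\<lambda>x. (u x + u' x) + (c x + d x))" by (simp add: algebra_simps)
    with linear_closed_add[OF assms u(1,2)] show "e \<in> ?R" by (rule translateI)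
  next
    fix e assume "e \<in> ?R"
    then obtain u where u: "u \<in> U" "e = (\<lambda>x. (u x + c x) + (0 + d x))"
      by (auto simp: translate_def add.assoc)
    have "(\<lambda>x. u x + c x) \<in> translate U c" "(\<lambda>x. 0 + d x) \<in> translate U d"
      using u(1) linear_closed_zero[OF assms] by (auto intro: translateI)
    then show "e \<in> ?L" using u(2) by blast
  qed
  then show ?thesis
    by (simp add: quotient_space_def set_add_def set_mult_def function_space_def)
qed

lemma smult_quotient:
  assumes "linear_closed U"
  shows "a \<odot>\<^bsub>quotient_space (function_space C) U\<^esub> translate U c = translate U (\<lambda>x. a * c x)"
proof -
  have "(\<Union>e\<in>translate U c. translate U (\<lambda>x. a * e x)) = translate U (\<lambda>x. a * c x)" (is "?L = ?R")
  proof (intro equalityI subsetI)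
    fix e assume "e \<in> ?L"
    then obtain u u' where u: "u \<in> U" "u' \<in> U" "e = (\<lambda>x. u x + a * (u' x + c x))"
      by (auto simp: translate_def)
    then have "e = (\<lambda>x. (u x + a * u' x) + a * c x)" by (simp add: algebra_simps)
    with linear_closed_add[OF assms u(1) linear_closed_smult[OF assms u(2)]]
    show "e \<in> ?R" by (rule translateI)
  next
    fix e assume "e \<in> ?R"
    then obtain u where u: "u \<in> U" "e = (\<lambda>x. u x + a * (0 + c x))"
      by (auto simp: translate_def)
    have "(\<lambda>x. 0 + c x) \<in> translate U c" using linear_closed_zero[OF assms] by (rule translateI) simp
    moreover have "e \<in> translate U (\<lambda>x. a * (0 + c x))" using u by (rule translateI)
    ultimately show "e \<in> ?L" by blast
  qed
  moreover have "U +>\<^bsub>function_space C\<^esub> e = translate U e" for e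
    by (auto simp: a_r_coset_def r_coset_def function_space_def translate_def)
  ultimately show ?thesis
    by (simp add: quotient_space_def function_space_def)
qed

lemma vectorspace_quotient:
  fixes C :: "('b \<Rightarrow> 'f::field) set"
  assumes C: "linear_closed C" and U: "linear_closed U"
  shows "vectorspace class_ring (quotient_space (function_space C) U)"
proof -
  let ?Q = "quotient_space (function_space C) U"
  note ops = carrier_quotient zero_quotient add_quotient[OF U] smult_quotient[OF U]
  note closed = linear_closed_zero[OF C] linear_closed_add[OF C] linear_closed_smult[OF C]
  have "abelian_group ?Q"
  proof (rule abelian_groupI)
    fix A assume "A \<in> carrier ?Q"
    then obtain c where c: "c \<in> C" "A = translate U c" by (auto simp: ops)
    show "\<exists>B\<in>carrier ?Q. B \<oplus>\<^bsub>?Q\<^esub> A = \<zero>\<^bsub>?Q\<^esub>"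
      using linear_closed_uminus[OF C c(1)]
      by (intro bexI[of _ "translate U (\<lambda>x. - c x)"]) (auto simp: ops c(2))
  qed (auto simp: ops closed add_ac)
  moreover have "field (class_ring :: 'f ring)" by (rule class_field)
  moreover have "cring (class_ring :: 'f ring)" by (rule field.axioms(1)[OF class_field, THEN domain.axioms(1)])
  ultimately show ?thesis
    unfolding vectorspace_def
    by (intro conjI moduleI) (auto simp: ops closed class_ring_simps distrib_left distrib_right mult.assoc)
qed

text \<open>Rank-nullity bounds the image when \<open>V\<close> is finite-dimensional; otherwise the
  right-hand side is infinite.\<close>

lemma vdim_surj_le:
  assumes V: "vectorspace class_ring V" and W: "vectorspace class_ring W"
    and T: "T \<in> LinearCombinations.module_hom class_ring V W" and surj: "T ` carrier V = carrier W"
  shows "vdim W \<le> vdim V"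
proof (cases "vectorspace.fin_dim class_ring V")
  case True
  interpret linear_map class_ring V W T
    using V W T unfolding linear_map_def mod_hom_def mod_hom_axioms_def vectorspace_def by blast
  have "W.fin_dim" using rank_nullity_main(2)[OF True surj] .
  moreover have "W.vs imT = W" using surj_imp_imT_carrier[OF surj] by simp
  then have "W.dim \<le> V.dim" using rank_nullity_main(1)[OF True] by simp
  ultimately show ?thesis using True by (simp add: vdim_def)
qed (simp add: vdim_def)

text \<open>A linear correspondence \<open>R\<close> in place of a map, so that no representatives need be chosen.\<close>
lemma vdim_quotient_le:
  fixes C U :: "('b \<Rightarrow> 'f::field) set" and D W :: "('c \<Rightarrow> 'f) set"
  assumes C: "linear_closed C" and U: "linear_closed U"
    and D: "linear_closed D" and W: "linear_closed W"
    and add: "\<And>c d c' d'. R c d \<Longrightarrow> R c' d' \<Longrightarrow> R (\<lambda>x. c x + c' x) (\<lambda>x. d x + d' x)"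
    and smult: "\<And>a c d. R c d \<Longrightarrow> R (\<lambda>x. a * c x) (\<lambda>x. a * d x)"
    and total: "\<And>c. c \<in> C \<Longrightarrow> \<exists>d\<in>D. R c d"
    and surj: "\<And>d. d \<in> D \<Longrightarrow> \<exists>c\<in>C. R c d"
    and univalent: "\<And>u d. u \<in> U \<Longrightarrow> R u d \<Longrightarrow> d \<in> W"
    and zero: "\<And>w. w \<in> W \<Longrightarrow> R (\<lambda>x. 0) w"
  shows "vdim (quotient_space (function_space D) W) \<le> vdim (quotient_space (function_space C) U)"
proof -
  \<comment> \<open>The induced map sends a coset to the set of all partners of its elements, which
    turns out to be a single coset of \<open>W\<close>.\<close>
  define T where "T A = {d. \<exists>c\<in>A. R c d}" for A
  have T: "T (translate U c) = translate W d" if cd: "R c d" for c d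
  proof (intro equalityI subsetI)
    fix e assume "e \<in> T (translate U c)"
    then obtain u where u: "u \<in> U" "R (\<lambda>x. u x + c x) e" by (auto simp: T_def translate_def)
    \<comment> \<open>Subtracting the pair \<open>c\<close>, \<open>d\<close> leaves a partner of
      \<open>u \<in> U\<close>, which \<open>univalent\<close> places in \<open>W\<close>.\<close>
    have "R u (\<lambda>x. e x + - 1 * d x)" using add[OF u(2) smult[OF cd, of "- 1"]] by simp
    then have "(\<lambda>x. e x - d x) \<in> W" using univalent[OF u(1)] by simp
    then show "e \<in> translate W d" by (rule translateI) simp
  next
    fix e assume "e \<in> translate W d"
    then obtain w where w: "w \<in> W" "e = (\<lambda>x. w x + d x)" by (auto simp: translate_def)
    have "R (\<lambda>x. 0 + c x) e" unfolding w(2) by (rule add[OF zero[OF w(1)] cd])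
    moreover have "(\<lambda>x. 0 + c x) \<in> translate U c"
      using linear_closed_zero[OF U] by (rule translateI) simp
    ultimately show "e \<in> T (translate U c)" unfolding T_def by blast
  qed
  show ?thesis
  proof (rule vdim_surj_le[OF vectorspace_quotient[OF C U] vectorspace_quotient[OF D W]])
    have "T (translate U c) \<in> translate W ` D" if c: "c \<in> C" for c
    proof -
      obtain d where "d \<in> D" "R c d" using total[OF c] by blast
      then show ?thesis using T[of c d] by simp
    qed
    moreover have "T (translate U (\<lambda>x. c x + c' x)) =
        T (translate U c) \<oplus>\<^bsub>quotient_space (function_space D) W\<^esub> T (translate U c')"
      if c: "c \<in> C" "c' \<in> C" for c c'
    proof -
      obtain d d' where d: "R c d" "R c' d'" using total c by blast
      show ?thesis by (simp add: T[OF d(1)] T[OF d(2)] T[OF add[OF d]] add_quotient[OF W])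
    qed
    moreover have "T (translate U (\<lambda>x. a * c x)) =
        a \<odot>\<^bsub>quotient_space (function_space D) W\<^esub> T (translate U c)" if c: "c \<in> C" for a c
    proof -
      obtain d where d: "R c d" using total c by blast
      show ?thesis by (simp add: T[OF d] T[OF smult[OF d]] smult_quotient[OF W])
    qed
    ultimately show "T \<in> LinearCombinations.module_hom class_ring (quotient_space (function_space C) U)
        (quotient_space (function_space D) W)"
      by (auto simp: LinearCombinations.module_hom_def carrier_quotient add_quotient[OF U] smult_quotient[OF U])
    show "T ` carrier (quotient_space (function_space C) U) =
        carrier (quotient_space (function_space D) W)"
    proof (intro equalityI subsetI)
      fix B assume "B \<in> T ` carrier (quotient_space (function_space C) U)"
      then obtain c where c: "c \<in> C" "B = T (translate U c)" by (auto simp: carrier_quotient)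
      then obtain d where "d \<in> D" "R c d" using total by blast
      then show "B \<in> carrier (quotient_space (function_space D) W)"
        using T[of c d] c(2) by (simp add: carrier_quotient)
    next
      fix B assume "B \<in> carrier (quotient_space (function_space D) W)"
      then obtain d where d: "d \<in> D" "B = translate W d" by (auto simp: carrier_quotient)
      then obtain c where c: "c \<in> C" "R c d" using surj by blast
      then have "B = T (translate U c)" using T[of c d] d(2) by simp
      then show "B \<in> T ` carrier (quotient_space (function_space C) U)"
        using c(1) by (auto simp: carrier_quotient)
    qed
  qed
qed

section \<open>Comparing the homology of the union and of the nerve\<close>

lemma reduced_homology_eq:
  "reduced_homology F X k = quotient_space (function_space (cycles F X k)) (boundaries F X k)"
  by (simp add: reduced_homology_def chain_space_def function_space_def)

lemma linear_closed_cycles: "linear_closed (cycles F X k)"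
proof -
  have "boundary (\<lambda>xs. c xs + d xs) = (\<lambda>xs. 0)"
    if "c \<in> cycles F X k" "d \<in> cycles F X k" for c d
    using that boundary_add[of c F X k d X k] by (simp add: cycles_def)
  then show ?thesis
    by (simp add: linear_closed_def chains_zero chains_add chains_smult boundary_zero boundary_smult
        cycles_def)
qed

lemma linear_closed_boundaries:
  fixes F :: "'f::field itself"
  shows "linear_closed (boundaries F X k)"
  unfolding linear_closed_def
proof (intro conjI ballI allI)
  show "(\<lambda>x. 0) \<in> boundaries F X k"
    unfolding boundaries_def by (rule image_eqI[OF _ chains_zero]) (simp add: boundary_zero)
next
  fix c d assume "c \<in> boundaries F X k" "d \<in> boundaries F X k"
  then obtain g h where "g \<in> simplicial_chains F X (k + 1)" "c = boundary g"
    "h \<in> simplicial_chains F X (k + 1)" "d = boundary h" by (auto simp: boundaries_def)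
  then show "(\<lambda>x. c x + d x) \<in> boundaries F X k"
    unfolding boundaries_def using boundary_add[of g F X "k + 1" h X "k + 1"]
    by (intro image_eqI[OF _ chains_add[of g F X "k + 1" h]]) simp_all
next
  fix a c assume "c \<in> boundaries F X k"
  then obtain g where "g \<in> simplicial_chains F X (k + 1)" "c = boundary g"
    by (auto simp: boundaries_def)
  then show "(\<lambda>x. a * c x) \<in> boundaries F X k"
    unfolding boundaries_def
    by (intro image_eqI[OF _ chains_smult[of g F X "k + 1" a]]) (simp_all add: boundary_smult)
qed

lemma boundary_of_cycle:
  assumes "carrier (reduced_homology F X k) = {\<zero>\<^bsub>reduced_homology F X k\<^esub>}"
    and "b \<in> simplicial_chains F X k" "boundary b = (\<lambda>xs. 0)"
  shows "\<exists>h\<in>simplicial_chains F X (k + 1). boundary h = b"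
proof -
  have "translate (boundaries F X k) b \<in> carrier (reduced_homology F X k)"
    using assms(2,3) by (simp add: reduced_homology_eq carrier_quotient cycles_def)
  then have "translate (boundaries F X k) b = boundaries F X k"
    unfolding assms(1) by (simp add: reduced_homology_eq zero_quotient translate_def)
  moreover have "b \<in> translate (boundaries F X k) b"
    using linear_closed_zero[OF linear_closed_boundaries] by (rule translateI) simp
  ultimately show ?thesis unfolding boundaries_def by auto
qed

context complex_family
begin

text \<open>On homology this is the graph of the map from the union to the nerve: include the union
  in the mixed complex, then invert the isomorphism induced by the inclusion of the nerve.\<close>

definition homologous :: "'f::field itself \<Rightarrow> int \<Rightarrow> ('a list \<Rightarrow> 'f) \<Rightarrow> ('i list \<Rightarrow> 'f) \<Rightarrow> bool" where
  "homologous F k a z \<longleftrightarrow> a \<in> cycles F (\<Union>i\<in>I. \<Gamma> i) k \<and> z \<in> cycles F (nerve I \<Gamma>) k \<and>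
     (\<lambda>xs. push Inl a xs - push Inr z xs) \<in> boundaries F (mixed I I) k"

lemma push_union_cycle:
  assumes "a \<in> cycles F (\<Union>i\<in>I. \<Gamma> i) k"
  shows "push Inl a \<in> simplicial_chains F (union_part I) k" "boundary (push Inl a) = (\<lambda>xs. 0)"
  using assms push_chains[of Inl a F] boundary_push[of Inl a F]
  by (auto simp: cycles_def union_part_def push_zero)

lemma push_nerve_cycle:
  assumes "z \<in> cycles F (nerve I \<Gamma>) k"
  shows "push Inr z \<in> simplicial_chains F (nerve_part I) k" "boundary (push Inr z) = (\<lambda>xs. 0)"
  using assms push_chains[of Inr z F] boundary_push[of Inr z F]
  by (auto simp: cycles_def nerve_part_def push_zero)

lemma ex_push_cycle:
  fixes c :: "'c list \<Rightarrow> 'f::field"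
  assumes f: "inj f" and c: "c \<in> simplicial_chains F ((`) f ` X) k" "boundary c = (\<lambda>xs. 0)"
  obtains b where "b \<in> cycles F X k" "push f b = c"
proof -
  obtain b where b: "b \<in> simplicial_chains F X k" "push f b = c" by (rule ex_push[OF f c(1)])
  have "push f (boundary b) = push f (\<lambda>xs. 0)"
    using boundary_push[OF f b(1)] b(2) c(2) by (simp add: push_zero)
  then have "boundary b = (\<lambda>xs. 0)" by (rule push_inject[OF f])
  then show ?thesis using that[of b] b by (simp add: cycles_def)
qed

lemma homologous_add:
  assumes "homologous F k a z" "homologous F k a' z'"
  shows "homologous F k (\<lambda>xs. a xs + a' xs) (\<lambda>xs. z xs + z' xs)"
proof -
  have "(\<lambda>xs. (push Inl a xs - push Inr z xs) + (push Inl a' xs - push Inr z' xs))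
      \<in> boundaries F (mixed I I) k"
    using assms by (intro linear_closed_add[OF linear_closed_boundaries]) (auto simp: homologous_def)
  then show ?thesis
    using assms
    by (auto simp: homologous_def push_add algebra_simps intro: linear_closed_add[OF linear_closed_cycles])
qed

lemma homologous_smult:
  assumes "homologous F k a z"
  shows "homologous F k (\<lambda>xs. r * a xs) (\<lambda>xs. r * z xs)"
proof -
  have "(\<lambda>xs. r * (push Inl a xs - push Inr z xs)) \<in> boundaries F (mixed I I) k"
    using assms by (intro linear_closed_smult[OF linear_closed_boundaries]) (auto simp: homologous_def)
  then show ?thesis
    using assms
    by (auto simp: homologous_def push_smult algebra_simps intro: linear_closed_smult[OF linear_closed_cycles])
qed

lemma homologous_total:
  assumes a: "a \<in> cycles F (\<Union>i\<in>I. \<Gamma> i) k"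
  shows "\<exists>z\<in>cycles F (nerve I \<Gamma>) k. homologous F k a z"
proof -
  note A = push_union_cycle[OF a]
  have A': "push Inl a \<in> simplicial_chains F (mixed I I) k"
    by (rule chains_mono[OF A(1) union_part_subset]) simp
  have "boundary (push Inl a) \<in> simplicial_chains F (nerve_part I) (k - 1)"
    unfolding A(2) by (rule chains_zero)
  then obtain h where h: "h \<in> simplicial_chains F (mixed I I) (k + 1)"
    "(\<lambda>xs. push Inl a xs - boundary h xs) \<in> simplicial_chains F (nerve_part I) k"
    using mixed_relative_acyclic[OF finite_I _ _ A'] by blast
  have dh: "boundary h \<in> simplicial_chains F (mixed I I) k"
    using boundary_chains[OF h(1) mixed_face] by simp
  have "boundary (\<lambda>xs. push Inl a xs - boundary h xs) = (\<lambda>xs. 0)"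
    unfolding boundary_diff[OF A(1) dh] A(2) boundary_boundary[OF h(1)] by simp
  then obtain z where z: "z \<in> cycles F (nerve I \<Gamma>) k"
    "push Inr z = (\<lambda>xs. push Inl a xs - boundary h xs)"
    using ex_push_cycle[of Inr "\<lambda>xs. push Inl a xs - boundary h xs" F] h(2)
    unfolding nerve_part_def by auto
  have "(\<lambda>xs. push Inl a xs - push Inr z xs) = boundary h" by (simp add: z(2))
  then have "homologous F k a z" using a z(1) h(1) by (simp add: homologous_def boundaries_def)
  then show ?thesis using z(1) by blast
qed

text \<open>If \<open>g\<close> bounds \<open>a\<close> and \<open>w\<close> bounds the difference
  of \<open>a\<close> and \<open>z\<close>, then \<open>push Inl g - w\<close> bounds
  \<open>z\<close> in the mixed complex. Relative acyclicity, one degree higher than for totality,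
  moves this chain into the nerve without changing its boundary.\<close>

lemma homologous_univalent:
  assumes a: "a \<in> boundaries F (\<Union>i\<in>I. \<Gamma> i) k" and az: "homologous F k a z"
  shows "z \<in> boundaries F (nerve I \<Gamma>) k"
proof -
  have inj: "inj (Inl :: 'a \<Rightarrow> 'a + 'i)" "inj (Inr :: 'i \<Rightarrow> 'a + 'i)" by simp_all
  obtain g where g: "g \<in> simplicial_chains F (\<Union>i\<in>I. \<Gamma> i) (k + 1)" "a = boundary g"
    using a by (auto simp: boundaries_def)
  obtain w where w: "w \<in> simplicial_chains F (mixed I I) (k + 1)"
    "boundary w = (\<lambda>xs. push Inl a xs - push Inr z xs)"
    using az by (auto simp: homologous_def boundaries_def)
  have z: "z \<in> cycles F (nerve I \<Gamma>) k" using az by (simp add: homologous_def)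
  have G: "push Inl g \<in> simplicial_chains F (mixed I I) (k + 1)"
    using chains_mono[OF push_chains[OF inj(1) g(1)] union_part_subset[unfolded union_part_def]] by simp
  define v where "v = (\<lambda>xs. push Inl g xs - w xs)"
  have v: "v \<in> simplicial_chains F (mixed I I) (k + 1)" unfolding v_def by (rule chains_diff[OF G w(1)])
  have dv: "boundary v = push Inr z"
    unfolding v_def boundary_diff[OF G w(1)] boundary_push[OF inj(1) g(1)] w(2) by (simp add: g(2))
  have "boundary v \<in> simplicial_chains F (nerve_part I) (k + 1 - 1)"
    using push_nerve_cycle(1)[OF z] dv by simp
  then obtain h where h: "h \<in> simplicial_chains F (mixed I I) (k + 1 + 1)"
    "(\<lambda>xs. v xs - boundary h xs) \<in> simplicial_chains F (nerve_part I) (k + 1)"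
    using mixed_relative_acyclic[OF finite_I _ _ v] by blast
  have "boundary h \<in> simplicial_chains F (mixed I I) (k + 1 + 1 - 1)"
    by (rule boundary_chains[OF h(1)]) (rule mixed_face[OF subset_refl subset_refl])
  then have dh: "boundary h \<in> simplicial_chains F (mixed I I) (k + 1)"
    by (simp only: add_diff_cancel_right')
  obtain b where b: "b \<in> simplicial_chains F (nerve I \<Gamma>) (k + 1)"
    "push Inr b = (\<lambda>xs. v xs - boundary h xs)"
    using ex_push[OF inj(2) h(2)[unfolded nerve_part_def]] by blast
  have "push Inr (boundary b) = push (Inr :: 'i \<Rightarrow> 'a + 'i) z"
    unfolding boundary_push[OF inj(2) b(1), symmetric] b(2) boundary_diff[OF v dh]
      boundary_boundary[OF h(1)] dv by simp
  then have "boundary b = z" by (rule push_inject[OF inj(2)])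
  then show ?thesis using b(1) by (auto simp: boundaries_def)
qed

lemma homologous_zero:
  assumes z: "z \<in> boundaries F (nerve I \<Gamma>) k"
  shows "homologous F k (\<lambda>xs. 0) z"
proof -
  have inj: "inj (Inr :: 'i \<Rightarrow> 'a + 'i)" by simp
  obtain g where g: "g \<in> simplicial_chains F (nerve I \<Gamma>) (k + 1)" "z = boundary g"
    using z by (auto simp: boundaries_def)
  define p where "p = push (Inr :: 'i \<Rightarrow> 'a + 'i) g"
  have p: "p \<in> simplicial_chains F (mixed I I) (k + 1)"
    unfolding p_def
    using chains_mono[OF push_chains[OF inj g(1)] nerve_part_subset[unfolded nerve_part_def]] .
  have "(\<lambda>xs. push Inl (\<lambda>xs. 0) xs - push Inr z xs) = boundary (\<lambda>xs. - p xs)"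
    by (simp add: p_def boundary_uminus boundary_push[OF inj g(1)] g(2) push_zero)
  then have "(\<lambda>xs. push Inl (\<lambda>xs. 0) xs - push Inr z xs) \<in> boundaries F (mixed I I) k"
    unfolding boundaries_def using chains_uminus[OF p] by (rule image_eqI)
  moreover have "z \<in> cycles F (nerve I \<Gamma>) k"
    using boundary_chains[OF g(1) nerve_face] boundary_boundary[OF g(1)] g(2) by (simp add: cycles_def)
  ultimately show ?thesis
    by (simp add: homologous_def linear_closed_zero[OF linear_closed_cycles])
qed

lemma homologous_surj:
  fixes F :: "'f::field itself"
  assumes acyclic: "\<And>\<sigma> b. \<sigma> \<in> nerve I \<Gamma> \<Longrightarrow> int (card \<sigma>) - 1 \<le> l \<Longrightarrow>
      b \<in> simplicial_chains F (\<Union>i\<in>\<sigma>. \<Gamma> i) (int (card \<sigma>) - 2) \<Longrightarrow> boundary b = (\<lambda>xs. 0) \<Longrightarrow>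
      \<exists>h\<in>simplicial_chains F (\<Union>i\<in>\<sigma>. \<Gamma> i) (int (card \<sigma>) - 1). boundary h = b"
    and l: "- 1 \<le> l" and z: "z \<in> cycles F (nerve I \<Gamma>) l"
  shows "\<exists>a\<in>cycles F (\<Union>i\<in>I. \<Gamma> i) l. homologous F l a z"
proof -
  \<comment> \<open>The parameter \<open>n\<close> of \<open>ex_deformation\<close> treats cycles of
    degree \<open>n - 1\<close>; the case \<open>l = -1\<close> is \<open>n = 0\<close>.\<close>
  have n: "int (nat (l + 1)) = l + 1" using l by simp
  note Z = push_nerve_cycle[OF z]
  obtain \<Phi> :: "(('a + 'i) list \<Rightarrow> 'f) \<Rightarrow> (('a + 'i) list \<Rightarrow> 'f)" where
    \<Phi>: "linear_comb_preserving \<Phi> \<and> (\<forall>t z. t \<subseteq> I \<longrightarrow>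
      z \<in> simplicial_chains F (nerve_part t) (int (nat (l + 1)) - 1) \<longrightarrow> boundary z = (\<lambda>xs. 0) \<longrightarrow>
      \<Phi> z \<in> simplicial_chains F (mixed t t) (int (nat (l + 1))) \<and>
      (\<lambda>xs. z xs - boundary (\<Phi> z) xs) \<in> simplicial_chains F (union_part t) (int (nat (l + 1)) - 1))"
    by (rule exE[OF ex_deformation[OF acyclic, where n = "nat (l + 1)"]]) (use l in auto)
  define w where "w = \<Phi> (push Inr z)"
  have w: "w \<in> simplicial_chains F (mixed I I) (l + 1)"
    "(\<lambda>xs. push Inr z xs - boundary w xs) \<in> simplicial_chains F (union_part I) l"
    using \<Phi>[THEN conjunct2, rule_format, OF subset_refl, unfolded n add_diff_cancel_right', OF Z]
    by (simp_all add: w_def)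
  have dw: "boundary w \<in> simplicial_chains F (mixed I I) l"
    using boundary_chains[OF w(1) mixed_face] by simp
  have "boundary (\<lambda>xs. push Inr z xs - boundary w xs) = (\<lambda>xs. 0)"
    unfolding boundary_diff[OF Z(1) dw] Z(2) boundary_boundary[OF w(1)] by simp
  then obtain a where a: "a \<in> cycles F (\<Union>i\<in>I. \<Gamma> i) l"
    "push Inl a = (\<lambda>xs. push Inr z xs - boundary w xs)"
    using ex_push_cycle[of Inl "\<lambda>xs. push Inr z xs - boundary w xs" F] w(2)
    unfolding union_part_def by auto
  have "(\<lambda>xs. push Inl a xs - push Inr z xs) = boundary (\<lambda>xs. - w xs)"
    by (simp add: a(2) boundary_uminus)
  then have "homologous F l a z"
    using a(1) z chains_uminus[OF w(1)] by (simp add: homologous_def boundaries_def)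
  then show ?thesis using a(1) by blast
qed

end


theorem theorem3:
  fixes F :: "'f::field itself"
    and X :: "'a set set"
    and I :: "'i set"
    and \<Gamma> :: "'i \<Rightarrow> 'a set set"
    and l :: int
  assumes "simplicial_complex X"
    and "finite I"
    and "\<And>i. i \<in> I \<Longrightarrow> subcomplex (\<Gamma> i) X"
    and "(\<Union>i\<in>I. \<Gamma> i) = X"
    and "-1 \<le> l" and "l < int (card I)"
    and "\<And>\<sigma>. \<sigma> \<in> nerve I \<Gamma> \<Longrightarrow> int (card \<sigma>) - 1 \<le> l \<Longrightarrow>
           carrier (reduced_homology F (\<Union>i\<in>\<sigma>. \<Gamma> i) (int (card \<sigma>) - 2)) =
             {\<zero>\<^bsub>reduced_homology F (\<Union>i\<in>\<sigma>. \<Gamma> i) (int (card \<sigma>) - 2)\<^esub>}"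
  shows "vdim (reduced_homology F (nerve I \<Gamma>) l) \<le> vdim (reduced_homology F X l)"
proof -
  interpret complex_family I \<Gamma>
    using assms(2,3) by unfold_locales (auto simp: subcomplex_def)
  have acyclic: "\<exists>h\<in>simplicial_chains F (\<Union>i\<in>\<sigma>. \<Gamma> i) (int (card \<sigma>) - 1). boundary h = b"
    if "\<sigma> \<in> nerve I \<Gamma>" "int (card \<sigma>) - 1 \<le> l"
      "b \<in> simplicial_chains F (\<Union>i\<in>\<sigma>. \<Gamma> i) (int (card \<sigma>) - 2)" "boundary b = (\<lambda>xs. 0)" for \<sigma> b
    using boundary_of_cycle[OF assms(7)[OF that(1,2)] that(3,4)] by (simp add: algebra_simps)
  show ?thesis
    unfolding reduced_homology_eq assms(4)[symmetric]
    \<comment> \<open>The vanishing hypothesis enters through \<open>homologous_surj\<close>;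
      totality and univalence come from relative acyclicity.\<close>
    by (rule vdim_quotient_le[where R = "homologous F l",
          OF linear_closed_cycles linear_closed_boundaries linear_closed_cycles linear_closed_boundaries
          homologous_add homologous_smult homologous_total homologous_surj[OF acyclic assms(5)]
          homologous_univalent homologous_zero])
qed

end
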